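(* Let $0<q<1$ and let $(a,c,d)$ be an admissible triple: $a>0$ and $(c,d)$ satisfies one of: $d=\bar c\in\mathbb C\setminus\mathbb R$; or $aq^m<c,d<aq^{m-1}$ for some $m\in\mathbb Z$; or $c,d<0$ and $q<cd^{-1}<q^{-1}$. Let $b<0$ be an extra parameter, subject, in the case $c,d<0$, to the additional constraint that $bq^{m-1}<c,d<bq^m$ for some $m\in\mathbb Z$. Then for every partition $\lambda$, $$\lim_{b\to0}\Phi^{bqJ}_\lambda(\,\cdot\,;q;a,b,c,d)=\Phi^{qM}_\lambda(\,\cdot\,;q;a,c,d)$$ (limit over such $b$) in the finite-dimensional space of symmetric functions of degree $\le|\lambda|$, where $\Phi^{bqJ}_\lambda$ and $\Phi^{qM}_\lambda$ are the big $q$-Jacobi and $q$-Meixner symmetric functions.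
   Context: Notation: $(x;q)_n=\prod_{k=0}^{n-1}(1-xq^k)$ for $n\ge0$, $(x_1,\dots,x_m;q)_n=\prod_j(x_j;q)_n$. $\ell(\lambda)$ is the number of nonzero parts, $|\lambda|=\sum\lambda_i$, $n(\lambda)=\sum_i(i-1)\lambda_i$, $\lambda'$ is the transposed partition (so $n(\lambda')=\sum_i\binom{\lambda_i}2$), $\mathbb Y(N)$ is the set of partitions with at most $N$ nonzero parts. $\mathrm{Sym}$ is the algebra of symmetric functions over $\mathbb C$, $\mathrm{Sym}(N)$ the symmetric polynomials in $N$ variables, the subscript $\le d$ means degree at most $d$. $V(x_1,\dots,x_N)=\prod_{i<j}(x_i-x_j)$. For variables $X=(x_1,x_2,\dots)$, $F(Xc)=F(cx_1,cx_2,\dots)$. Interpolation functions: $(x\mid c_0,c_1,\dots)^m=\prod_{i=0}^{m-1}(x-c_i)$; for $\mu\in\mathbb Y(N)$, $s_{\mu|N}(x_1,\dots,x_N\mid c_0,c_1,\dots)=\det[(x_j\mid c_0,c_1,\dots)^{\mu_i+N-i}]_{i,j=1}^N/V(x_1,\dots,x_N)$. $I^A_\mu(\cdot;q)\in\mathrm{Sym}$ is the limit as $N\to\infty$ (which exists) of $s_{\mu|N}(\cdot\mid q^{N-1},q^{N-2},\dots)$, where $F_N\in\mathrm{Sym}(N)$ converges to $F\in\mathrm{Sym}$ if $\sup_N\deg F_N<\infty$ and, for every sufficiently large $d$, $\iota_{d,N}(F_N)\to F$ in $\mathrm{Sym}_{\le d}$; for $N\ge d$, $\iota_{d,N}:\mathrm{Sym}_{\le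 d}(N)\to\mathrm{Sym}_{\le d}$ is the inverse of the isomorphism $F\mapsto F(x_1,\dots,x_N,0,0,\dots)$. Big $q$-Jacobi symmetric functions: $\Phi^{bqJ}_\lambda(X;q;a,b,c,d)=\sum_{\mu\subseteq\lambda}\sigma^{bqJ}(\lambda,\mu;q;a,b,c,d)\,I^A_\mu(Xc;q)$ with $$\sigma^{bqJ}(\lambda,\mu;q;a,b,c,d)=c^{-|\lambda|}\det\left[\frac{\left(\frac caq^{\mu_k+2-k},\frac cbq^{\mu_k+2-k};q\right)_{\lambda_j-j-\mu_k+k}}{q^{(\mu_k+1-k)(\lambda_j-j-\mu_k+k)}\left(q,\frac{cd}{ab}q^{\lambda_j+\mu_k+3-j-k};q\right)_{\lambda_j-j-\mu_k+k}}\right]_{j,k=1}^{\ell(\lambda)}.$$ $q$-Meixner symmetric functions: $\Phi^{qM}_\lambda(X;q;a,c,d)=\sum_{\mu\subseteq\lambda}\sigma^{qM}(\lambda,\mu;q;a,c,d)\,I^A_\mu(Xc;q)$ with $$\sigma^{qM}(\lambda,\mu;q;a,c,d)=c^{-|\lambda|}\left(\frac a{qd}\right)^{|\lambda|-|\mu|}q^{2\{n(\mu')-n(\mu)-n(\lambda')+n(\lambda)\}}\det\left[\frac{\left(\frac caq^{\mu_k+2-k};q\right)_{\lambda_j-j-\mu_k+k}}{(q;q)_{\lambda_j-j-\mu_k+k}}\right]_{j,k=1}^{\ell(\lambda)}.$$ In both determinants an entry with $\lambda_j-j-\mu_k+k<0$ is $0$, and the empty determinant is $1$. *)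

theory Defs
  imports
    "HOL-Analysis.Function_Topology"
    "HOL-Library.Poly_Mapping"
    "HOL-Combinatorics.Permutations"
    "Jordan_Normal_Form.Determinant"
begin

section \<open>Partitions\<close>

text \<open>A partition is an infinite weakly decreasing sequence with finitely many nonzero terms.
  Indexing starts at 0, so the part usually written \<open>\<lambda>\<^sub>i\<close> (with \<open>i \<ge> 1\<close>) is \<^term>\<open>lam (i - 1)\<close>.
  Containment of diagrams is the pointwise order on functions.\<close>

definition is_partition :: "(nat \<Rightarrow> nat) \<Rightarrow> bool" where
  "is_partition lam \<longleftrightarrow> antimono lam \<and> finite {i. lam i \<noteq> 0}"

definition plength :: "(nat \<Rightarrow> nat) \<Rightarrow> nat" where
  "plength lam = card {i. lam i \<noteq> 0}"

definition psize :: "(nat \<Rightarrow> nat) \<Rightarrow> nat" where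
  "psize lam = (\<Sum>i | lam i \<noteq> 0. lam i)"

definition ptranspose :: "(nat \<Rightarrow> nat) \<Rightarrow> nat \<Rightarrow> nat" where
  "ptranspose lam j = card {i. j < lam i}"

text \<open>\<open>n(\<lambda>) = \<Sum> (i - 1) \<lambda>\<^sub>i\<close>; the factor is \<open>i\<close> because indices start at 0.\<close>

definition pn :: "(nat \<Rightarrow> nat) \<Rightarrow> nat" where
  "pn lam = (\<Sum>i | lam i \<noteq> 0. i * lam i)"

definition det1 :: "nat \<Rightarrow> (nat \<Rightarrow> nat \<Rightarrow> 'a) \<Rightarrow> 'a :: comm_ring_1" where
  \<comment> \<open>\<open>det [f i j]\<close> with \<open>i, j = 1, \<dots>, n\<close>\<close>
  "det1 n f = Determinant.det (Matrix.mat n n (\<lambda>(i, j). f (Suc i) (Suc j)))"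


section \<open>Symmetric polynomials and symmetric functions\<close>

text \<open>A monomial is a finitely supported exponent vector; the variables are numbered from 0.
  A polynomial is a finitely supported family of coefficients, and a formal series in infinitely
  many variables is an arbitrary family of coefficients.\<close>

type_synonym monomial = "nat \<Rightarrow>\<^sub>0 nat"
type_synonym mpolynomial = "monomial \<Rightarrow>\<^sub>0 complex"
type_synonym series = "monomial \<Rightarrow> complex"

definition mdeg :: "monomial \<Rightarrow> nat" where
  "mdeg m = (\<Sum>i \<in> Poly_Mapping.keys m. Poly_Mapping.lookup m i)"

definition var :: "nat \<Rightarrow> mpolynomial" where
  "var i = Poly_Mapping.single (Poly_Mapping.single i 1) 1"

definition const :: "complex \<Rightarrow> mpolynomial" where
  "const z = Poly_Mapping.single 0 z"

definition perm_invariant :: "nat \<Rightarrow> series \<Rightarrow> bool" where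
  "perm_invariant n F \<longleftrightarrow>
     (\<forall>\<pi> m. \<pi> permutes {..<n} \<longrightarrow> F (Poly_Mapping.map_key \<pi> m) = F m)"

definition deg_le :: "nat \<Rightarrow> series \<Rightarrow> bool" where
  "deg_le d F \<longleftrightarrow> (\<forall>m. F m \<noteq> 0 \<longrightarrow> mdeg m \<le> d)"

text \<open>\<open>Sym(N)\<^sub>\<le>\<^sub>d\<close>\<close>

definition SymN_le :: "nat \<Rightarrow> nat \<Rightarrow> mpolynomial set" where
  "SymN_le d N = {p. (\<forall>m \<in> Poly_Mapping.keys p. Poly_Mapping.keys m \<subseteq> {..<N}) \<and>
                     perm_invariant N (Poly_Mapping.lookup p) \<and>
                     deg_le d (Poly_Mapping.lookup p)}"

text \<open>\<open>Sym\<^sub>\<le>\<^sub>d\<close>; the algebra \<open>Sym\<close> is the union of these spaces over all \<open>d\<close>.\<close>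

definition Sym_le :: "nat \<Rightarrow> series set" where
  "Sym_le d = {F. (\<forall>n. perm_invariant n F) \<and> deg_le d F}"

text \<open>\<^term>\<open>Sym_le d\<close> is finite dimensional, since an element is determined by its coefficients at
  the finitely many monomials with weakly decreasing exponents and degree at most \<open>d\<close>. Its
  topology as a finite-dimensional complex vector space is therefore that of convergence of
  coefficients, i.e. the one induced by the product topology on families of coefficients.\<close>

definition Sym_le_topology :: "nat \<Rightarrow> series topology" where
  "Sym_le_topology d = subtopology euclidean (Sym_le d)"

text \<open>\<open>F(x\<^sub>1, \<dots>, x\<^sub>N, 0, 0, \<dots>)\<close>. For \<open>F\<close> of bounded degree the family of coefficients below has
  finite support, so that \<^const>\<open>Poly_Mapping.Abs_poly_mapping\<close> is applied within its domain.\<close>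

definition truncate_vars :: "nat \<Rightarrow> series \<Rightarrow> mpolynomial" where
  "truncate_vars N F =
     Poly_Mapping.Abs_poly_mapping (\<lambda>m. if Poly_Mapping.keys m \<subseteq> {..<N} then F m else 0)"

text \<open>The inverse \<open>\<iota>\<^bsub>d,N\<^esub> : Sym(N)\<^sub>\<le>\<^sub>d \<rightarrow> Sym\<^sub>\<le>\<^sub>d\<close> of the truncation, meaningful for \<open>N \<ge> d\<close>.\<close>

definition sym_lift :: "nat \<Rightarrow> nat \<Rightarrow> mpolynomial \<Rightarrow> series" where
  "sym_lift d N = inv_into (Sym_le d) (truncate_vars N)"

text \<open>Convergence of a sequence \<open>F\<^sub>N \<in> Sym(N)\<close>, of uniformly bounded degree, to \<open>F \<in> Sym\<close>. The
  sequence need only be given for large \<open>N\<close>, as in the case of interpolation polynomials labelled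
  by \<open>\<mu>\<close>, which are defined for \<open>N \<ge> \<ell>(\<mu>)\<close>.\<close>

definition sym_converges :: "(nat \<Rightarrow> mpolynomial) \<Rightarrow> series \<Rightarrow> bool" where
  "sym_converges f F \<longleftrightarrow>
     (\<exists>D. \<forall>\<^sub>F N in sequentially. f N \<in> SymN_le D N) \<and>
     (\<forall>\<^sub>F d in sequentially.
        limitin (Sym_le_topology d) (\<lambda>N. sym_lift d N (f N)) F sequentially)"

text \<open>\<open>F(Xc)\<close>\<close>

definition scale_vars :: "complex \<Rightarrow> series \<Rightarrow> series" where
  "scale_vars c F = (\<lambda>m. c ^ mdeg m * F m)"


section \<open>Interpolation symmetric functions\<close>

definition gen_power :: "mpolynomial \<Rightarrow> (nat \<Rightarrow> complex) \<Rightarrow> nat \<Rightarrow> mpolynomial" where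
  "gen_power x c m = (\<Prod>i<m. x - const (c i))"

definition vandermonde :: "nat \<Rightarrow> mpolynomial" where
  "vandermonde N = (\<Prod>(i, j) \<in> {(i, j). i < j \<and> j < N}. var i - var j)"

text \<open>The quotient \<open>det [\<dots>] / V\<close> is the unique polynomial whose product with \<open>V\<close> is the
  determinant.\<close>

definition interp_schur :: "(nat \<Rightarrow> nat) \<Rightarrow> nat \<Rightarrow> (nat \<Rightarrow> complex) \<Rightarrow> mpolynomial" where
  "interp_schur mu N c =
     (THE p. p * vandermonde N =
        det1 N (\<lambda>i j. gen_power (var (j - 1)) c (mu (i - 1) + N - i)))"

definition I_A :: "(nat \<Rightarrow> nat) \<Rightarrow> complex \<Rightarrow> series" where
  "I_A mu q =
     (THE F. sym_converges
        (\<lambda>N. interp_schur mu N (\<lambda>i. q powi (int N - 1 - int i))) F)"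


section \<open>Big $q$-Jacobi and $q$-Meixner symmetric functions\<close>

definition qpoch :: "complex \<Rightarrow> complex \<Rightarrow> nat \<Rightarrow> complex" where
  "qpoch x q n = (\<Prod>k<n. 1 - x * q ^ k)"

definition sigma_bqJ ::
  "(nat \<Rightarrow> nat) \<Rightarrow> (nat \<Rightarrow> nat) \<Rightarrow>
   complex \<Rightarrow> complex \<Rightarrow> complex \<Rightarrow> complex \<Rightarrow> complex \<Rightarrow> complex" where
  "sigma_bqJ lam mu q a b c d =
     c powi (- int (psize lam)) *
     det1 (plength lam) (\<lambda>j k.
       let l = int (lam (j - 1)); u = int (mu (k - 1));
           e = l - int j - u + int k; n = nat e
       in if e < 0 then 0
          else qpoch (c / a * q powi (u + 2 - int k)) q n *
               qpoch (c / b * q powi (u + 2 - int k)) q n /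
               (q powi ((u + 1 - int k) * e) *
                (qpoch q q n *
                 qpoch (c * d / (a * b) * q powi (l + u + 3 - int j - int k)) q n)))"

definition sigma_qM ::
  "(nat \<Rightarrow> nat) \<Rightarrow> (nat \<Rightarrow> nat) \<Rightarrow>
   complex \<Rightarrow> complex \<Rightarrow> complex \<Rightarrow> complex \<Rightarrow> complex" where
  "sigma_qM lam mu q a c d =
     c powi (- int (psize lam)) *
     (a / (q * d)) powi (int (psize lam) - int (psize mu)) *
     q powi (2 * (int (pn (ptranspose mu)) - int (pn mu)
                  - int (pn (ptranspose lam)) + int (pn lam))) *
     det1 (plength lam) (\<lambda>j k.
       let l = int (lam (j - 1)); u = int (mu (k - 1));
           e = l - int j - u + int k; n = nat e
       in if e < 0 then 0
          else qpoch (c / a * q powi (u + 2 - int k)) q n / qpoch q q n)"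

definition Phi_bqJ ::
  "(nat \<Rightarrow> nat) \<Rightarrow>
   complex \<Rightarrow> complex \<Rightarrow> complex \<Rightarrow> complex \<Rightarrow> complex \<Rightarrow> series" where
  "Phi_bqJ lam q a b c d =
     (\<lambda>m. \<Sum>mu | is_partition mu \<and> mu \<le> lam.
        sigma_bqJ lam mu q a b c d * scale_vars c (I_A mu q) m)"

definition Phi_qM ::
  "(nat \<Rightarrow> nat) \<Rightarrow>
   complex \<Rightarrow> complex \<Rightarrow> complex \<Rightarrow> complex \<Rightarrow> series" where
  "Phi_qM lam q a c d =
     (\<lambda>m. \<Sum>mu | is_partition mu \<and> mu \<le> lam.
        sigma_qM lam mu q a c d * scale_vars c (I_A mu q) m)"


section \<open>Admissible parameters\<close>

definition both_between :: "real \<Rightarrow> real \<Rightarrow> complex \<Rightarrow> complex \<Rightarrow> bool" where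
  \<comment> \<open>\<open>x < c, d < y\<close>, which includes that \<open>c\<close> and \<open>d\<close> are real\<close>
  "both_between x y c d \<longleftrightarrow>
     c \<in> \<real> \<and> d \<in> \<real> \<and> x < Re c \<and> Re c < y \<and> x < Re d \<and> Re d < y"

definition both_negative :: "complex \<Rightarrow> complex \<Rightarrow> bool" where
  "both_negative c d \<longleftrightarrow> c \<in> \<real> \<and> d \<in> \<real> \<and> Re c < 0 \<and> Re d < 0"

definition admissible_triple :: "real \<Rightarrow> real \<Rightarrow> complex \<Rightarrow> complex \<Rightarrow> bool" where
  "admissible_triple q a c d \<longleftrightarrow> a > 0 \<and>
     (c \<notin> \<real> \<and> d = cnj c \<or>
      (\<exists>m::int. both_between (a * q powi m) (a * q powi (m - 1)) c d) \<or>
      both_negative c d \<and> q < Re c / Re d \<and> Re c / Re d < 1 / q)"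

definition admissible_b :: "real \<Rightarrow> complex \<Rightarrow> complex \<Rightarrow> real set" where
  "admissible_b q c d = {b. b < 0 \<and>
     (both_negative c d \<longrightarrow>
        (\<exists>m::int. both_between (b * q powi (m - 1)) (b * q powi m) c d))}"

end

theory Submission
  imports Defs
begin

text \<open>The coefficients \<open>\<sigma>\<close> converge entrywise: as \<open>b \<rightarrow> 0\<close> the \<open>b\<close>-dependent quotient of
  \<open>q\<close>-shifted factorials in an entry tends to a monomial, which splits into a factor depending on the
  row and one depending on the column. What remains is that every \<open>I\<^sup>A\<^sub>\<mu>\<close> is a genuine symmetric
  function of degree at most \<open>|\<mu>|\<close>, i.e. that its defining limit exists. Newton interpolation at the
  nodes \<open>x\<^sub>1, \<dots>, x\<^sub>N\<close> factors the numerator alternant as \<open>det G \<cdot> V\<close>, so the interpolation polynomial is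
  \<open>det G\<close>, whose degree and symmetry are visible. Substituting \<open>q\<^sup>N\<close> for \<open>x\<^sub>N\<^sub>+\<^sub>1\<close> turns the polynomial in
  \<open>N + 1\<close> variables into the one in \<open>N\<close> variables; as \<open>\<Sum> q\<^sup>N\<close> converges, the coefficients stay
  bounded and form Cauchy sequences.\<close>

section \<open>Polynomials\<close>

abbreviation lookup where "lookup \<equiv> Poly_Mapping.lookup"
abbreviation keys where "keys \<equiv> Poly_Mapping.keys"
abbreviation map_key where "map_key \<equiv> Poly_Mapping.map_key"

section \<open>Degree and support of monomials\<close>

lemma mdeg_eq_sum:
  assumes "finite S" "keys m \<subseteq> S"
  shows "mdeg m = (\<Sum>i\<in>S. lookup m i)"
  unfolding mdeg_def using assms
  by (intro sum.mono_neutral_left) (auto simp: in_keys_iff)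

lemma mdeg_add: "mdeg (m + n) = mdeg m + mdeg n"
proof -
  have "mdeg k = (\<Sum>i\<in>keys m \<union> keys n. lookup k i)" if "k \<in> {m, n, m + n}" for k
    using that keys_add[of m n] by (intro mdeg_eq_sum) auto
  then show ?thesis by (simp add: lookup_add sum.distrib)
qed

lemma mdeg_single [simp]: "mdeg (Poly_Mapping.single i k) = k"
  by (simp add: mdeg_def)

lemma mdeg_zero [simp]: "mdeg 0 = 0"
  by (simp add: mdeg_def)

lemma keys_add_nat: "keys (m + n) = keys m \<union> keys (n :: monomial)"
  by (auto simp: in_keys_iff lookup_add)

lemma card_keys_le_mdeg: "card (keys m) \<le> mdeg m"
proof -
  have "(\<Sum>i\<in>keys m. 1) \<le> (\<Sum>i\<in>keys m. lookup m i)"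
    by (intro sum_mono) (auto simp: in_keys_iff)
  then show ?thesis by (simp add: mdeg_def)
qed

lemma lookup_map_key: "inj f \<Longrightarrow> lookup (map_key f p) = lookup p \<circ> f"
  by (simp add: map_key.rep_eq)

lemma mdeg_map_key:
  assumes "bij f" shows "mdeg (map_key f m) = mdeg m"
proof -
  have "inj f" using assms by (rule bij_is_inj)
  have "(\<Sum>i\<in>f -` keys m. lookup m (f i)) = (\<Sum>i\<in>keys m. lookup m i)"
    using inj_on_subset[OF \<open>inj f\<close>] surj_image_vimage_eq[OF bij_is_surj[OF assms]]
    by (intro sum.reindex_bij_betw bij_betw_imageI) auto
  then show ?thesis using \<open>inj f\<close> by (simp add: mdeg_def keys_map_key lookup_map_key)
qed

lemma poly_mapping_sum_single:
  "p = (\<Sum>k\<in>keys p. Poly_Mapping.single k (lookup p k))"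
  by (rule poly_mapping_eqI)
    (auto simp: lookup_sum lookup_single when_def in_keys_iff)

text \<open>The bound is an integer because Newton coefficients have degree bound
  \<open>m - k\<close>, which may be negative. A negative bound forces the zero polynomial, and
  bounds of products add without truncation.\<close>

definition poly_within :: "nat set \<Rightarrow> int \<Rightarrow> mpolynomial \<Rightarrow> bool" where
  "poly_within S e p \<longleftrightarrow> (\<forall>m\<in>keys p. keys m \<subseteq> S \<and> int (mdeg m) \<le> e)"

lemma poly_within_zero: "poly_within S e 0"
  by (simp add: poly_within_def)

lemma poly_within_const: "0 \<le> e \<Longrightarrow> poly_within S e (const z)"
  by (simp add: poly_within_def const_def)

lemma poly_within_one: "0 \<le> e \<Longrightarrow> poly_within S e 1"
  by (simp add: poly_within_def)

lemma poly_within_var: "i \<in> S \<Longrightarrow> 1 \<le> e \<Longrightarrow> poly_within S e (var i)"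
  by (simp add: poly_within_def var_def)

lemma poly_within_add: "poly_within S e p \<Longrightarrow> poly_within S e r \<Longrightarrow> poly_within S e (p + r)"
  unfolding poly_within_def using keys_add[of p r] by blast

lemma poly_within_uminus: "poly_within S e p \<Longrightarrow> poly_within S e (- p)"
  by (simp add: poly_within_def in_keys_iff del: keys_eq_empty)

lemma poly_within_diff: "poly_within S e p \<Longrightarrow> poly_within S e r \<Longrightarrow> poly_within S e (p - r)"
  using poly_within_add[of S e p "- r"] poly_within_uminus[of S e r] by simp

lemma poly_within_mult:
  assumes "poly_within S e p" "poly_within S e' r"
  shows "poly_within S (e + e') (p * r)"
  unfolding poly_within_def
proof
  fix m assume "m \<in> keys (p * r)"
  then obtain k l where m: "m = k + l" and "k \<in> keys p" "l \<in> keys r"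
    using keys_mult[of p r] by blast
  then have "keys k \<subseteq> S \<and> int (mdeg k) \<le> e" "keys l \<subseteq> S \<and> int (mdeg l) \<le> e'"
    using assms by (auto simp: poly_within_def)
  then show "keys m \<subseteq> S \<and> int (mdeg m) \<le> e + e'"
    by (simp add: m keys_add_nat mdeg_add)
qed

lemma poly_within_sum:
  "(\<And>i. i \<in> I \<Longrightarrow> poly_within S e (f i)) \<Longrightarrow> poly_within S e (\<Sum>i\<in>I. f i)"
  by (induction I rule: infinite_finite_induct) (auto simp: poly_within_zero poly_within_add)

lemma poly_within_prod:
  "(\<And>i. i \<in> I \<Longrightarrow> poly_within S (e i) (f i)) \<Longrightarrow> poly_within S (\<Sum>i\<in>I. e i) (\<Prod>i\<in>I. f i)"
  by (induction I rule: infinite_finite_induct) (auto simp: poly_within_one poly_within_mult)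

text \<open>The inner \<open>map_key\<close> acts on exponent vectors, so the coefficient at
  \<open>m\<close> is read off at \<open>map_key f m\<close>. This is the action in
  \<open>perm_invariant\<close>, and it sends \<open>var i\<close> to
  \<open>var (f i)\<close>.\<close>

definition rename_vars :: "(nat \<Rightarrow> nat) \<Rightarrow> mpolynomial \<Rightarrow> mpolynomial" where
  "rename_vars f p = map_key (map_key f) p"

lemma bij_map_key:
  assumes "bij f" shows "bij (map_key f :: monomial \<Rightarrow> monomial)"
proof (rule bij_betw_byWitness[where f' = "map_key (inv_into UNIV f)"])
  have "bij (inv_into UNIV f)" using assms by (rule bij_imp_bij_inv)
  note inj = bij_is_inj[OF assms] bij_is_inj[OF this]
  show "\<forall>m\<in>UNIV. map_key (inv_into UNIV f) (map_key f m) = m"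
    using assms inj by (auto intro!: poly_mapping_eqI simp: lookup_map_key surj_f_inv_f bij_is_surj)
  show "\<forall>m\<in>UNIV. map_key f (map_key (inv_into UNIV f) m) = m"
    using assms inj by (auto intro!: poly_mapping_eqI simp: lookup_map_key)
qed auto

lemma lookup_rename_vars:
  "bij f \<Longrightarrow> lookup (rename_vars f p) m = lookup p (map_key f m)"
  by (simp add: rename_vars_def lookup_map_key bij_is_inj bij_map_key)

context
  fixes f :: "nat \<Rightarrow> nat"
  assumes f: "bij f"
begin

lemma rename_vars_add: "rename_vars f (p + r) = rename_vars f p + rename_vars f r"
  by (rule poly_mapping_eqI) (simp add: lookup_rename_vars f lookup_add)

lemma rename_vars_zero: "rename_vars f 0 = 0"
  by (rule poly_mapping_eqI) (simp add: lookup_rename_vars f)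

lemma rename_vars_sum: "rename_vars f (\<Sum>i\<in>I. g i) = (\<Sum>i\<in>I. rename_vars f (g i))"
  by (induction I rule: infinite_finite_induct) (auto simp: rename_vars_zero rename_vars_add)

lemma rename_vars_single:
  "rename_vars f (Poly_Mapping.single (map_key f m) z) = Poly_Mapping.single m z"
  unfolding rename_vars_def using bij_is_inj[OF bij_map_key[OF f]] by (rule map_key_single)

lemma rename_vars_const: "rename_vars f (const z) = const z"
  using rename_vars_single[of 0 z] by (simp add: const_def map_key_zero[OF bij_is_inj[OF f]])

lemma rename_vars_var: "rename_vars f (var i) = var (f i)"
  using rename_vars_single[of "Poly_Mapping.single (f i) 1" 1] bij_is_inj[OF f]
  by (simp add: var_def)

text \<open>By bilinearity single terms suffice. There bijectivity writes every monomial as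
  \<open>map_key f\<close> of another one, the form that \<open>rename_vars_single\<close>
  evaluates.\<close>

lemma rename_vars_mult: "rename_vars f (p * r) = rename_vars f p * rename_vars f r"
proof -
  have single: "rename_vars f (Poly_Mapping.single m z * Poly_Mapping.single n w) =
      rename_vars f (Poly_Mapping.single m z) * rename_vars f (Poly_Mapping.single n w)" for m n z w
  proof -
    obtain m' n' where mn: "m = map_key f m'" "n = map_key f n'"
      using bij_is_surj[OF bij_map_key[OF f]] by (metis surjD)
    have "m + n = map_key f (m' + n')"
      by (simp add: mn map_key_plus bij_is_inj[OF f])
    then show ?thesis
      by (simp add: mult_single rename_vars_single) (simp add: mn rename_vars_single mult_single)
  qed
  have "rename_vars f (p * r) = rename_vars f
     ((\<Sum>k\<in>keys p. Poly_Mapping.single k (lookup p k)) *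
      (\<Sum>k\<in>keys r. Poly_Mapping.single k (lookup r k)))"
    using poly_mapping_sum_single[of p] poly_mapping_sum_single[of r] by simp
  also have "\<dots> = rename_vars f (\<Sum>k\<in>keys p. Poly_Mapping.single k (lookup p k)) *
      rename_vars f (\<Sum>k\<in>keys r. Poly_Mapping.single k (lookup r k))"
    by (simp only: sum_product rename_vars_sum single)
  also have "\<dots> = rename_vars f p * rename_vars f r"
    using poly_mapping_sum_single[of p] poly_mapping_sum_single[of r] by simp
  finally show ?thesis .
qed

lemma comm_ring_hom_rename_vars: "comm_ring_hom (rename_vars f)"
proof
  show "rename_vars f 1 = 1" using rename_vars_const[of 1] by (simp add: const_def)
qed (simp_all add: rename_vars_zero rename_vars_add rename_vars_mult)

end

section \<open>Newton interpolation and determinants\<close>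

text \<open>Divided differences of \<open>\<Prod>i<m. t - c i\<close> at the nodes
  \<open>y 0, ..., y k\<close>, given by a division-free recursion so that they make sense in any
  commutative ring. The recursion comes from
  \<open>t - c m = (t - y k) + (y k - c m)\<close>.\<close>

fun newton_coeff :: "(nat \<Rightarrow> 'a) \<Rightarrow> (nat \<Rightarrow> 'a) \<Rightarrow> nat \<Rightarrow> nat \<Rightarrow> 'a :: comm_ring_1" where
  "newton_coeff y c 0 k = (if k = 0 then 1 else 0)"
| "newton_coeff y c (Suc m) k =
     (if k = 0 then 0 else newton_coeff y c m (k - 1)) + (y k - c m) * newton_coeff y c m k"

lemma newton_coeff_eq_0: "m < k \<Longrightarrow> newton_coeff y c m k = 0"
  by (induction m arbitrary: k) auto

lemma newton_coeff_diag: "newton_coeff y c m m = 1"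
  by (induction m) (auto simp: newton_coeff_eq_0)

lemma newton_coeff_0: "newton_coeff y c m 0 = (\<Prod>i<m. y 0 - c i)"
  by (induction m) (auto simp: mult.commute)

lemma newton_expansion:
  "(\<Prod>i<m. t - c i) = (\<Sum>k\<le>m. newton_coeff y c m k * (\<Prod>l<k. t - y l))"
proof (induction m)
  case (Suc m)
  let ?P = "\<lambda>k. \<Prod>l<k. t - y l"
  have "(\<Sum>k\<le>Suc m. newton_coeff y c (Suc m) k * ?P k) =
      (\<Sum>k\<le>Suc m. (if k = 0 then 0 else newton_coeff y c m (k - 1)) * ?P k) +
      (\<Sum>k\<le>Suc m. (y k - c m) * newton_coeff y c m k * ?P k)"
    by (simp only: newton_coeff.simps distrib_right sum.distrib)
  also have "(\<Sum>k\<le>Suc m. (if k = 0 then 0 else newton_coeff y c m (k - 1)) * ?P k) =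
      (\<Sum>k\<le>m. (t - y k) * newton_coeff y c m k * ?P k)"
    by (subst sum.atMost_Suc_shift) (simp add: mult_ac)
  also have "(\<Sum>k\<le>Suc m. (y k - c m) * newton_coeff y c m k * ?P k) =
      (\<Sum>k\<le>m. (y k - c m) * newton_coeff y c m k * ?P k)"
    by (simp add: newton_coeff_eq_0)
  also have "(\<Sum>k\<le>m. (t - y k) * newton_coeff y c m k * ?P k) + \<dots> =
      (t - c m) * (\<Sum>k\<le>m. newton_coeff y c m k * ?P k)"
    by (simp add: sum.distrib[symmetric] sum_distrib_left algebra_simps)
  finally show ?case using Suc by (simp add: mult.commute)
qed simp

text \<open>At the node \<open>y j\<close> the basis products with \<open>k > j\<close> vanish, so
  \<open>n\<close> columns suffice for every exponent \<open>m\<close>. This makes the factorisation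
  below one of square matrices.\<close>

lemma newton_expansion_node:
  assumes "j < n"
  shows "(\<Prod>i<m. y j - c i) = (\<Sum>k<n. newton_coeff y c m k * (\<Prod>l<k. y j - y l))"
proof -
  have z: "(\<Prod>l<k. y j - y l) = 0" if "\<not> k \<le> j" for k
    using that by (intro prod_zero) auto
  have "(\<Prod>i<m. y j - c i) = (\<Sum>k\<le>m. newton_coeff y c m k * (\<Prod>l<k. y j - y l))"
    by (rule newton_expansion)
  \<comment> \<open>\<open>m\<close> and \<open>n\<close> are not comparable, so the range is first
    enlarged to contain both.\<close>
  also have "\<dots> = (\<Sum>k\<le>m + n. newton_coeff y c m k * (\<Prod>l<k. y j - y l))"
    by (rule sum.mono_neutral_left) (auto simp: newton_coeff_eq_0)
  also have "\<dots> = (\<Sum>k<n. newton_coeff y c m k * (\<Prod>l<k. y j - y l))"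
    using assms by (intro sum.mono_neutral_right) (auto simp: z)
  finally show ?thesis .
qed

definition newton_det :: "(nat \<Rightarrow> 'a) \<Rightarrow> (nat \<Rightarrow> 'a) \<Rightarrow> (nat \<Rightarrow> nat) \<Rightarrow> nat \<Rightarrow> 'a :: comm_ring_1" where
  "newton_det y c e n = det (mat n n (\<lambda>(r, k). newton_coeff y c (e r) k))"

text \<open>The expansion at the nodes factors the matrix into Newton coefficients times values of
  the Newton basis. The second factor is triangular, and its diagonal gives the Vandermonde
  product.\<close>

lemma det_gen_power_eq:
  fixes y c :: "nat \<Rightarrow> 'a :: comm_ring_1"
  shows "det (mat n n (\<lambda>(r, j). \<Prod>i<e r. y j - c i)) =
    newton_det y c e n * (\<Prod>j<n. \<Prod>l<j. y j - y l)"
proof -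
  let ?G = "mat n n (\<lambda>(r, k). newton_coeff y c (e r) k)"
  let ?T = "mat n n (\<lambda>(k, j). \<Prod>l<k. y j - y l)"
  have "mat n n (\<lambda>(r, j). \<Prod>i<e r. y j - c i) = ?G * ?T"
    by (rule eq_matI)
      (auto simp: scalar_prod_def newton_expansion_node[of _ n] atLeast0LessThan intro!: sum.cong)
  moreover have "det ?T = (\<Prod>j<n. \<Prod>l<j. y j - y l)"
  proof -
    have "(\<Prod>l<k. y j - y l) = 0" if "j < k" for j k
      using that by (intro prod_zero) auto
    then have "upper_triangular ?T"
      by (auto intro!: upper_triangularI)
    then have "det ?T = prod_list (diag_mat ?T)"
      by (rule det_upper_triangular[of _ n]) auto
    also have "\<dots> = (\<Prod>j<n. \<Prod>l<j. y j - y l)"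
      by (simp add: prod_list_diag_prod atLeast0LessThan)
    finally show ?thesis .
  qed
  ultimately show ?thesis
    unfolding newton_det_def by (simp add: det_mult[of _ n])
qed

lemma newton_det_triangular:
  assumes "\<And>r. r < n \<Longrightarrow> e r = r"
  shows "newton_det y c e n = 1"
proof -
  have "det (mat n n (\<lambda>(r, k). newton_coeff y c (e r) k)) =
      prod_list (diag_mat (mat n n (\<lambda>(r, k). newton_coeff y c (e r) k)))"
    by (rule det_lower_triangular[of n]) (auto simp: assms newton_coeff_eq_0)
  also have "\<dots> = 1"
    by (simp add: prod_list_diag_prod assms newton_coeff_diag)
  finally show ?thesis unfolding newton_det_def .
qed

section \<open>Determinants under permutations and congruences\<close>

lemma det_permute_rows_columns:
  fixes A :: "'a :: comm_ring_1 mat"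
  assumes A: "A \<in> carrier_mat n n" and p: "p permutes {..<n}"
  shows "det (mat n n (\<lambda>(i, j). A $$ (p i, p j))) = det A"
proof -
  have p': "p permutes {0..<n}" and lt: "\<And>i. i < n \<Longrightarrow> p i < n"
    using p permutes_in_image[OF p] by (auto simp: atLeast0LessThan)
  let ?B = "mat n n (\<lambda>(i, j). A $$ (p i, j))"
  have "det (mat n n (\<lambda>(i, j). A $$ (p i, p j))) = det (mat n n (\<lambda>(i, j). transpose_mat ?B $$ (p i, j)))"
    by (subst det_transpose[of _ n, symmetric]) (auto intro!: arg_cong[of _ _ det] eq_matI simp: lt)
  also have "\<dots> = signof p * det (transpose_mat ?B)"
    by (rule det_permute_rows[OF _ p']) auto
  also have "det (transpose_mat ?B) = det ?B"
    by (rule det_transpose[of _ n]) auto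
  also have "det ?B = signof p * det A"
    by (rule det_permute_rows[OF A p'])
  finally show ?thesis by (simp add: sign_def)
qed

lemma dvd_prod_diff:
  fixes f g :: "'b \<Rightarrow> 'a :: comm_ring_1"
  assumes "\<And>i. i \<in> I \<Longrightarrow> z dvd f i - g i"
  shows "z dvd prod f I - prod g I"
  using assms
proof (induction I rule: infinite_finite_induct)
  case (insert i I)
  have "prod f (insert i I) - prod g (insert i I) =
      (f i - g i) * prod f I + g i * (prod f I - prod g I)"
    using insert by (simp add: algebra_simps)
  then show ?case using insert by (auto intro!: dvd_add)
qed auto

text \<open>Congruent entries give congruent Leibniz terms.\<close>

lemma dvd_det_diff:
  fixes A B :: "'a :: comm_ring_1 mat"
  assumes "A \<in> carrier_mat n n" "B \<in> carrier_mat n n"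
    and "\<And>i j. i < n \<Longrightarrow> j < n \<Longrightarrow> z dvd A $$ (i, j) - B $$ (i, j)"
  shows "z dvd det A - det B"
proof -
  have "z dvd (\<Prod>i = 0..<n. A $$ (i, p i)) - (\<Prod>i = 0..<n. B $$ (i, p i))"
    if "p permutes {0..<n}" for p
    using permutes_in_image[OF that] assms(3) by (intro dvd_prod_diff) auto
  then show ?thesis
    unfolding det_def'[OF assms(1)] det_def'[OF assms(2)] sum_subtractf[symmetric]
      right_diff_distrib[symmetric]
    by (intro dvd_sum dvd_mult) auto
qed

text \<open>If \<open>y 0 = c 0\<close>, then \<open>t - y 0\<close> divides
  \<open>\<Prod>i<Suc m. t - c i\<close> and every basis product of positive index; cancelling it
  leaves the expansion for the shifted data. The induction carries this out modulo
  \<open>y 0 - c 0\<close>.\<close>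

lemma newton_coeff_Suc_cong:
  "(y 0 - c 0) dvd newton_coeff y c (Suc m) (Suc k) - newton_coeff (y \<circ> Suc) (c \<circ> Suc) m k"
proof (induction m arbitrary: k)
  case 0
  then show ?case by simp
next
  case (Suc m)
  let ?z = "y 0 - c 0" and ?N = "newton_coeff y c" and ?N' = "newton_coeff (y \<circ> Suc) (c \<circ> Suc)"
  \<comment> \<open>The same congruence one index lower, extended to \<open>k = 0\<close>: there the
    coefficient is a product containing the factor \<open>y 0 - c 0\<close>.\<close>
  have 1: "?z dvd ?N (Suc m) k - (if k = 0 then 0 else ?N' m (k - 1))"
  proof (cases k)
    case 0
    have "?z dvd (\<Prod>i<Suc m. y 0 - c i)" by (rule dvd_prodI) auto
    then show ?thesis by (simp only: 0 newton_coeff_0) simp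
  next
    case (Suc k')
    then show ?thesis using Suc.IH[of k'] by (simp del: newton_coeff.simps o_apply)
  qed
  \<comment> \<open>Both recursions have the multiplier \<open>y (Suc k) - c (Suc m)\<close>, so the
    difference is a combination of two multiples of \<open>?z\<close>.\<close>
  have "?N (Suc (Suc m)) (Suc k) - ?N' (Suc m) k =
      (?N (Suc m) k - (if k = 0 then 0 else ?N' m (k - 1))) +
      (y (Suc k) - c (Suc m)) * (?N (Suc m) (Suc k) - ?N' m k)"
    by (simp del: newton_coeff.simps add: newton_coeff.simps(2)[of y c "Suc m"]
        newton_coeff.simps(2)[of "y \<circ> Suc" "c \<circ> Suc"]) (simp only: algebra_simps)
  then show ?case by (simp only:) (intro dvd_add dvd_mult 1 Suc.IH)
qed

text \<open>The first row of the larger determinant is \<open>(1, 0, \<dots>, 0)\<close>, and modulo \<open>y\<^sub>0 - c\<^sub>0\<close> the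
  remaining minor is the smaller determinant. This is the stability of interpolation polynomials.\<close>

lemma newton_det_Suc_cong:
  assumes "e 0 = 0" and "\<And>r. r < n \<Longrightarrow> e (Suc r) = Suc (e' r)"
  shows "(y 0 - c 0) dvd newton_det y c e (Suc n) - newton_det (y \<circ> Suc) (c \<circ> Suc) e' n"
proof -
  let ?A = "mat (Suc n) (Suc n) (\<lambda>(r, k). newton_coeff y c (e r) k)"
  have "det ?A = (\<Sum>j<Suc n. ?A $$ (0, j) * cofactor ?A 0 j)"
    by (rule laplace_expansion_row) auto
  also have "\<dots> = cofactor ?A 0 0"
    by (subst sum.lessThan_Suc_shift) (simp add: assms(1))
  also have "\<dots> = det (mat_delete ?A 0 0)"
    by (simp add: cofactor_def)
  also have "mat_delete ?A 0 0 = mat n n (\<lambda>(r, k). newton_coeff y c (e (Suc r)) (Suc k))"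
    by (rule eq_matI) (auto simp: mat_delete_def)
  finally have "newton_det y c e (Suc n) =
      det (mat n n (\<lambda>(r, k). newton_coeff y c (e (Suc r)) (Suc k)))"
    unfolding newton_det_def .
  then show ?thesis
    unfolding newton_det_def
    by (simp only:) (rule dvd_det_diff[of _ n],
      auto simp: assms(2) newton_coeff_Suc_cong simp del: newton_coeff.simps)
qed

section \<open>Interpolation polynomials: symmetry, degree and stability\<close>

lemma det_permute_columns:
  fixes A :: "'a :: comm_ring_1 mat"
  assumes A: "A \<in> carrier_mat n n" and p: "p permutes {0..<n}"
  shows "det (mat n n (\<lambda>(i, j). A $$ (i, p j))) = signof p * det A"
proof -
  have lt: "p i < n" if "i < n" for i
    using permutes_in_image[OF p, of i] that by simp
  have "det (mat n n (\<lambda>(i, j). A $$ (i, p j))) =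
      det (transpose_mat (mat n n (\<lambda>(i, j). A $$ (i, p j))))"
    by (rule det_transpose[of _ n, symmetric]) auto
  also have "transpose_mat (mat n n (\<lambda>(i, j). A $$ (i, p j))) =
      mat n n (\<lambda>(i, j). transpose_mat A $$ (p i, j))"
    using A by (intro eq_matI) (auto simp: lt)
  also have "det \<dots> = signof p * det (transpose_mat A)"
    using A by (intro det_permute_rows[OF _ p]) auto
  also have "det (transpose_mat A) = det A"
    using A by (rule det_transpose)
  finally show ?thesis .
qed

text \<open>Rows and variables are listed in reverse. Node 0 is the last variable, so a new variable
  becomes the new node 0; row 0 has exponent \<open>mu (N - 1)\<close>, which is 0 once
  \<open>N\<close> exceeds the number of parts. This is the shape required by
  \<open>newton_det_Suc_cong\<close>.\<close>

definition interp_det :: "(nat \<Rightarrow> nat) \<Rightarrow> nat \<Rightarrow> (nat \<Rightarrow> complex) \<Rightarrow> mpolynomial" where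
  "interp_det mu N c =
     newton_det (\<lambda>j. var (N - 1 - j)) (\<lambda>i. const (c i)) (\<lambda>r. mu (N - 1 - r) + r) N"

definition alternant :: "(nat \<Rightarrow> nat) \<Rightarrow> nat \<Rightarrow> (nat \<Rightarrow> complex) \<Rightarrow> mpolynomial" where
  "alternant mu N c = det1 N (\<lambda>i j. gen_power (var (j - 1)) c (mu (i - 1) + N - i))"

lemma vandermonde_reverse:
  "vandermonde N = (\<Prod>j<N. \<Prod>l<j. var (N - 1 - j) - var (N - 1 - l))"
proof -
  have "(\<Prod>j<N. \<Prod>l<j. var (N - 1 - j) - var (N - 1 - l)) =
      (\<Prod>(j, l)\<in>Sigma {..<N} lessThan. var (N - 1 - j) - var (N - 1 - l))"
    by (rule prod.Sigma) auto
  also have "\<dots> = vandermonde N"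
    unfolding vandermonde_def
    by (rule prod.reindex_bij_witness[of _ "\<lambda>(i, j). (N - 1 - i, N - 1 - j)"
          "\<lambda>(i, j). (N - 1 - i, N - 1 - j)"]) auto
  finally show ?thesis ..
qed

lemma interp_det_mult_vandermonde: "interp_det mu N c * vandermonde N = alternant mu N c"
proof -
  \<comment> \<open>\<open>p\<close> reverses rows and columns alike, so its sign cancels.\<close>
  define p where "p i = (if i < N then N - 1 - i else i)" for i
  have "p permutes {..<N}"
    by (rule bij_imp_permutes)
      (auto simp: p_def intro!: bij_betw_byWitness[where f' = p])
  let ?A = "mat N N (\<lambda>(i, j). gen_power (var j) c (mu i + N - Suc i))"
  have "alternant mu N c = det ?A"
    by (simp add: alternant_def det1_def)
  also have "\<dots> = det (mat N N (\<lambda>(i, j). ?A $$ (p i, p j)))"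
    by (rule det_permute_rows_columns[symmetric]) (auto simp: \<open>p permutes {..<N}\<close>)
  also have "mat N N (\<lambda>(i, j). ?A $$ (p i, p j)) =
      mat N N (\<lambda>(r, j). \<Prod>i<mu (N - 1 - r) + r. var (N - 1 - j) - const (c i))"
    by (rule eq_matI) (auto simp: p_def gen_power_def)
  also have "det \<dots> = interp_det mu N c * vandermonde N"
    unfolding det_gen_power_eq interp_det_def vandermonde_reverse ..
  finally show ?thesis ..
qed

lemma var_eq_iff: "var i = var j \<longleftrightarrow> i = j"
proof
  assume "var i = var j"
  then have "keys (var i) = keys (var j)" by simp
  then have "Poly_Mapping.single i (1::nat) = Poly_Mapping.single j 1"
    by (simp add: var_def)
  then have "keys (Poly_Mapping.single i (1::nat)) = keys (Poly_Mapping.single j (1::nat))"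
    by simp
  then show "i = j" by simp
qed simp

lemma finite_vandermonde_index: "finite {(i, j). i < j \<and> j < (N::nat)}"
  by (rule finite_subset[of _ "{..<N} \<times> {..<N}"]) auto

lemma vandermonde_nonzero: "vandermonde N \<noteq> 0"
  unfolding vandermonde_def
  by (auto simp: prod_zero_iff[OF finite_vandermonde_index] var_eq_iff)

lemma interp_schur_eq: "interp_schur mu N c = interp_det mu N c"
  unfolding interp_schur_def alternant_def[symmetric]
proof (rule the_equality)
  fix p assume "p * vandermonde N = alternant mu N c"
  then have "p * vandermonde N = interp_det mu N c * vandermonde N"
    by (simp add: interp_det_mult_vandermonde)
  then show "p = interp_det mu N c"
    using vandermonde_nonzero by (metis mult_right_cancel)
qed (rule interp_det_mult_vandermonde)

text \<open>The exponents are \<open>0, ..., N - 1\<close>, so the Newton matrix is unitriangular.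
  The antisymmetry of alternants thereby covers the Vandermonde product too.\<close>

lemma alternant_zero: "alternant (\<lambda>_. 0) N c = vandermonde N"
  unfolding interp_det_mult_vandermonde[symmetric] interp_det_def
  by (simp add: newton_det_triangular)

text \<open>A ring homomorphism commutes with the determinant, and renaming variables permutes the
  columns.\<close>

lemma rename_vars_alternant:
  assumes "\<pi> permutes {..<N}"
  shows "rename_vars \<pi> (alternant mu N c) = signof \<pi> * alternant mu N c"
proof -
  have bij: "bij \<pi>" using assms by (rule permutes_bij)
  then interpret comm_ring_hom "rename_vars \<pi>" by (rule comm_ring_hom_rename_vars)
  have p: "\<pi> permutes {0..<N}" using assms by (simp add: atLeast0LessThan)
  have lt: "\<pi> i < N" if "i < N" for i
    using permutes_in_image[OF p, of i] that by simp
  let ?A = "mat N N (\<lambda>(i, j). gen_power (var j) c (mu i + N - Suc i))"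
  have A: "alternant mu N c = det ?A"
    by (simp add: alternant_def det1_def)
  have "rename_vars \<pi> (det ?A) = det (map_mat (rename_vars \<pi>) ?A)"
    by simp
  also have "map_mat (rename_vars \<pi>) ?A = mat N N (\<lambda>(i, j). ?A $$ (i, \<pi> j))"
    by (rule eq_matI)
      (auto simp: gen_power_def hom_prod hom_minus rename_vars_var rename_vars_const bij lt)
  also have "det \<dots> = signof \<pi> * det ?A"
    by (rule det_permute_columns[OF _ p]) auto
  finally show ?thesis by (simp only: A)
qed

text \<open>Numerator and denominator change by the same sign, and the nonzero Vandermonde product
  can be cancelled.\<close>

lemma rename_vars_interp_det:
  assumes "\<pi> permutes {..<N}"
  shows "rename_vars \<pi> (interp_det mu N c) = interp_det mu N c"
proof -
  let ?p = "interp_det mu N c" and ?V = "vandermonde N"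
  have bij: "bij \<pi>" using assms by (rule permutes_bij)
  have "rename_vars \<pi> ?p * rename_vars \<pi> ?V = signof \<pi> * (?p * ?V)"
    using rename_vars_alternant[OF assms, of mu c]
    by (simp add: interp_det_mult_vandermonde[symmetric] rename_vars_mult bij)
  also have "rename_vars \<pi> ?V = signof \<pi> * ?V"
    using rename_vars_alternant[OF assms, of "\<lambda>_. 0" c] by (simp add: alternant_zero)
  finally have "signof \<pi> * rename_vars \<pi> ?p * ?V = signof \<pi> * ?p * ?V"
    by (simp add: mult_ac)
  then have "signof \<pi> * rename_vars \<pi> ?p = signof \<pi> * ?p"
    using vandermonde_nonzero by (metis mult_right_cancel)
  then show ?thesis by (auto simp: sign_def split: if_splits)
qed

text \<open>One summand of the recursion leaves \<open>m - k\<close> unchanged; in the other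
  \<open>m - k\<close> grows by one and a factor of degree at most 1 is added.\<close>

lemma poly_within_newton_coeff:
  assumes "0 < N" "k < N"
  shows "poly_within {..<N} (int m - int k)
    (newton_coeff (\<lambda>j. var (N - 1 - j)) (\<lambda>i. const (c i)) m k)"
  using assms(2)
proof (induction m arbitrary: k)
  case 0
  then show ?case by (auto simp: poly_within_one poly_within_zero)
next
  case (Suc m)
  let ?n = "newton_coeff (\<lambda>j. var (N - 1 - j)) (\<lambda>i. const (c i)) m"
  have "poly_within {..<N} (int (Suc m) - int k) (if k = 0 then 0 else ?n (k - 1))"
    using Suc.IH[of "k - 1"] Suc.prems
    by (cases k) (auto simp: poly_within_zero)
  moreover have "poly_within {..<N} 1 (var (N - 1 - k) - const (c m))"
    using assms(1) by (intro poly_within_diff poly_within_var poly_within_const) auto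
  from poly_within_mult[OF this Suc.IH[OF Suc.prems]]
  have "poly_within {..<N} (int (Suc m) - int k) ((var (N - 1 - k) - const (c m)) * ?n k)"
    by (simp add: algebra_simps)
  ultimately show ?case by (auto intro: poly_within_add)
qed

text \<open>In each Leibniz term the bounds \<open>mu (N - 1 - r) + r - p r\<close> add up to the
  sum of the \<open>mu i\<close>, since \<open>p\<close> only rearranges the numbers
  \<open>r\<close>.\<close>

lemma poly_within_interp_det:
  "poly_within {..<N} (int (\<Sum>i<N. mu i)) (interp_det mu N c)"
proof -
  let ?G = "mat N N (\<lambda>(r, k). newton_coeff (\<lambda>j. var (N - 1 - j)) (\<lambda>i. const (c i))
    (mu (N - 1 - r) + r) k)"
  have "poly_within {..<N} (int (\<Sum>i<N. mu i)) (signof p * (\<Prod>i = 0..<N. ?G $$ (i, p i)))"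
    if p: "p permutes {0..<N}" for p
  proof -
    have lt: "p i < N" if "i < N" for i
      using permutes_in_image[OF p, of i] that by simp
    have "(\<Sum>r = 0..<N. int (mu (N - 1 - r) + r) - int (p r)) =
        (\<Sum>r<N. int (mu (N - Suc r))) + ((\<Sum>r = 0..<N. int r) - (\<Sum>r = 0..<N. int (p r)))"
      by (simp add: sum.distrib sum_subtractf atLeast0LessThan)
    also have "(\<Sum>r = 0..<N. int (p r)) = (\<Sum>r = 0..<N. int r)"
      using sum.permute[OF p, of int] by (simp add: comp_def)
    also have "(\<Sum>r<N. int (mu (N - Suc r))) = (\<Sum>i<N. int (mu i))"
      by (rule sum.nat_diff_reindex)
    finally have deg: "(\<Sum>r = 0..<N. int (mu (N - 1 - r) + r) - int (p r)) = int (\<Sum>i<N. mu i)"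
      by simp
    have "poly_within {..<N} (\<Sum>r = 0..<N. int (mu (N - 1 - r) + r) - int (p r))
        (\<Prod>i = 0..<N. ?G $$ (i, p i))"
    proof (rule poly_within_prod)
      fix i assume "i \<in> {0..<N}"
      then show "poly_within {..<N} (int (mu (N - 1 - i) + i) - int (p i)) (?G $$ (i, p i))"
        using poly_within_newton_coeff[of N "p i" "mu (N - 1 - i) + i" c] lt[of i] by auto
    qed
    then show ?thesis
      unfolding deg by (auto simp: sign_def poly_within_uminus)
  qed
  then have "poly_within {..<N} (int (\<Sum>i<N. mu i)) (det ?G)"
    by (subst det_def'[of _ N]) (auto intro!: poly_within_sum)
  then show ?thesis by (simp add: interp_det_def newton_det_def)
qed

lemma interp_det_SymN_le:
  assumes "(\<Sum>i<N. mu i) \<le> D"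
  shows "interp_det mu N c \<in> SymN_le D N"
proof -
  have "perm_invariant N (lookup (interp_det mu N c))"
    unfolding perm_invariant_def
    by (metis lookup_rename_vars permutes_bij rename_vars_interp_det)
  moreover have "\<forall>m\<in>keys (interp_det mu N c). keys m \<subseteq> {..<N} \<and> mdeg m \<le> D"
    using poly_within_interp_det[of N mu c] assms unfolding poly_within_def
    by (meson of_nat_le_iff order_trans)
  ultimately show ?thesis
    by (auto simp: SymN_le_def deg_le_def in_keys_iff)
qed

lemma interp_det_Suc_cong:
  assumes "mu N = 0"
  shows "(var N - const (c 0)) dvd interp_det mu (Suc N) c - interp_det mu N (c \<circ> Suc)"
proof -
  let ?y = "\<lambda>j. var (Suc N - 1 - j)" and ?c = "\<lambda>i. const (c i)"
  have "(?y 0 - ?c 0) dvd newton_det ?y ?c (\<lambda>r. mu (Suc N - 1 - r) + r) (Suc N)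
     - newton_det (?y \<circ> Suc) (?c \<circ> Suc) (\<lambda>r. mu (N - 1 - r) + r) N"
    by (rule newton_det_Suc_cong) (auto simp: assms)
  moreover have "?y \<circ> Suc = (\<lambda>j. var (N - 1 - j))" "?c \<circ> Suc = (\<lambda>i. const ((c \<circ> Suc) i))"
    by auto
  ultimately show ?thesis by (simp add: interp_det_def)
qed

section \<open>Convergence of symmetric polynomials\<close>

lemma limitin_Sym_le_topology:
  "limitin (Sym_le_topology d) f F G \<longleftrightarrow>
     F \<in> Sym_le d \<and> (\<forall>\<^sub>F x in G. f x \<in> Sym_le d) \<and> (\<forall>m. ((\<lambda>x. f x m) \<longlongrightarrow> F m) G)"
  unfolding Sym_le_topology_def limitin_subtopology euclidean_product_topology[symmetric]
  by (simp add: limitin_componentwise)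

lemma Sym_le_mono: "d \<le> e \<Longrightarrow> Sym_le d \<subseteq> Sym_le e"
  by (force simp: Sym_le_def deg_le_def)

lemma SymN_le_mono: "d \<le> e \<Longrightarrow> SymN_le d N \<subseteq> SymN_le e N"
  by (force simp: SymN_le_def deg_le_def)

section \<open>Truncation to finitely many variables and its inverse\<close>

lemma finite_bounded_monomials: "finite {m. keys m \<subseteq> {..<N} \<and> mdeg m \<le> d}"
proof (rule inj_on_finite)
  let ?M = "{m. keys m \<subseteq> {..<N} \<and> mdeg m \<le> d}"
  let ?h = "\<lambda>m. map (lookup m) [0..<N]"
  show "inj_on ?h ?M"
  proof (rule inj_onI, rule poly_mapping_eqI)
    fix m n i assume mn: "m \<in> ?M" "n \<in> ?M" and eq: "?h m = ?h n"
    show "lookup m i = lookup n i"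
    proof (cases "i < N")
      case True
      then show ?thesis using arg_cong[OF eq, of "\<lambda>xs. xs ! i"] by simp
    next
      case False
      then have "i \<notin> keys m" "i \<notin> keys n" using mn by auto
      then show ?thesis by (simp add: in_keys_iff)
    qed
  qed
  have le: "lookup m i \<le> mdeg m" for m i
    by (cases "i \<in> keys m")
      (simp_all add: mdeg_def member_le_sum not_in_keys_iff_lookup_eq_zero)
  have "lookup m i \<le> d" if "mdeg m \<le> d" for m i
    using le[of m i] that by simp
  then show "?h ` ?M \<subseteq> {xs. set xs \<subseteq> {..d} \<and> length xs = N}"
    by auto
qed (simp add: finite_lists_length_eq)

lemma lookup_truncate_vars:
  assumes "F \<in> Sym_le d"
  shows "lookup (truncate_vars N F) m = (if keys m \<subseteq> {..<N} then F m else 0)"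
proof -
  have "finite {m. (if keys m \<subseteq> {..<N} then F m else 0) \<noteq> 0}"
    using assms by (intro finite_subset[OF _ finite_bounded_monomials[of N d]])
      (auto simp: Sym_le_def deg_le_def)
  then show ?thesis unfolding truncate_vars_def by simp
qed

text \<open>The nonzero exponents with multiplicity, a complete invariant of a monomial up to
  permutation of the variables.\<close>

definition exponents :: "monomial \<Rightarrow> nat multiset" where
  "exponents m = image_mset (lookup m) (mset_set (keys m))"

lemma exponents_map_key:
  assumes "bij f" shows "exponents (map_key f m) = exponents m"
proof -
  have "inj f" using assms by (rule bij_is_inj)
  have "inj_on f (f -` keys m)" using \<open>inj f\<close> by (rule inj_on_subset) simp
  have "image_mset f (mset_set (f -` keys m)) = mset_set (keys m)"
    using image_mset_mset_set[OF \<open>inj_on f (f -` keys m)\<close>]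
    by (simp add: surj_image_vimage_eq bij_is_surj[OF assms])
  then show ?thesis
    using \<open>inj f\<close> unfolding exponents_def
    by (metis (no_types, lifting) keys_map_key lookup_map_key multiset.map_comp)
qed

lemma exponents_eq_imp_permutation:
  assumes "keys m \<subseteq> {..<N}" "keys n \<subseteq> {..<N}" "exponents m = exponents n"
  obtains \<pi> where "\<pi> permutes {..<N}" "m = map_key \<pi> n"
proof -
  \<comment> \<open>Padding with zeros gives the multiset of all exponents on the first
    \<open>N\<close> variables; equality of these multisets yields the permutation.\<close>
  have full: "image_mset (lookup k) (mset_set {..<N}) =
      exponents k + replicate_mset (N - size (exponents k)) 0" if k: "keys k \<subseteq> {..<N}" for k
  proof -
    have "mset_set {..<N} = mset_set (keys k) + mset_set ({..<N} - keys k)"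
      using k by (subst mset_set_Union[symmetric]) (auto simp: Un_absorb1)
    moreover have "image_mset (lookup k) (mset_set ({..<N} - keys k)) =
        image_mset (\<lambda>_. 0) (mset_set ({..<N} - keys k))"
      by (rule image_mset_cong) (auto simp: in_keys_iff)
    moreover have "size (mset_set ({..<N} - keys k)) = N - size (exponents k)"
      using k by (simp add: exponents_def card_Diff_subset)
    ultimately show ?thesis
      by (simp add: exponents_def image_mset_const_eq)
  qed
  then have "image_mset (lookup m) (mset_set {..<N}) = image_mset (lookup n) (mset_set {..<N})"
    using assms by simp
  then obtain \<pi> where \<pi>: "\<pi> permutes {..<N}" "\<forall>i\<in>{..<N}. lookup m i = lookup n (\<pi> i)"
    using image_mset_eq_implies_permutes[of "{..<N}"] by (metis finite_lessThan)
  have "lookup m i = lookup n (\<pi> i)" for i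
  proof (cases "i < N")
    case False
    then have "i \<notin> keys m" "i \<notin> keys n" "\<pi> i = i"
      using assms \<pi>(1) by (auto simp: permutes_def)
    then show ?thesis by (simp add: in_keys_iff)
  qed (use \<pi> in auto)
  then have "m = map_key \<pi> n"
    using permutes_inj[OF \<pi>(1)] by (intro poly_mapping_eqI) (simp add: lookup_map_key)
  then show ?thesis using that \<pi>(1) by blast
qed

text \<open>The coefficient of a monomial is copied from one with the same exponents that uses only
  the first \<open>N\<close> variables.\<close>

lemma truncate_vars_surj:
  assumes p: "p \<in> SymN_le d N"
  shows "p \<in> truncate_vars N ` Sym_le d"
proof
  \<comment> \<open>If no such \<open>n\<close> exists, the choice is arbitrary but still depends
    only on \<open>exponents m\<close>, so \<open>F\<close> stays symmetric. The cutoff in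
    \<open>F\<close> keeps the degree bound in that case.\<close>
  define r where "r m = (SOME n. keys n \<subseteq> {..<N} \<and> exponents n = exponents m)" for m
  define F where "F m = (if mdeg m \<le> d then lookup p (r m) else 0)" for m
  have r_cong: "r m = r n" if "exponents m = exponents n" for m n
    using that by (simp add: r_def)
  have F_eq: "F m = lookup p m" if m: "keys m \<subseteq> {..<N}" for m
  proof (cases "mdeg m \<le> d")
    case True
    have "keys (r m) \<subseteq> {..<N} \<and> exponents (r m) = exponents m"
      unfolding r_def by (rule someI[of _ m]) (simp add: m)
    then obtain \<pi> where "\<pi> permutes {..<N}" "r m = map_key \<pi> m"
      using exponents_eq_imp_permutation[of "r m" N m] m by metis
    then show ?thesis using p True by (simp add: F_def SymN_le_def perm_invariant_def)
  next
    case False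
    then show ?thesis using p by (auto simp: F_def SymN_le_def deg_le_def)
  qed
  show F: "F \<in> Sym_le d"
    by (auto simp: Sym_le_def perm_invariant_def deg_le_def F_def permutes_bij mdeg_map_key
        intro!: arg_cong[where f = "lookup p"] r_cong exponents_map_key)
  show "p = truncate_vars N F"
  proof (rule poly_mapping_eqI)
    fix m
    show "lookup p m = lookup (truncate_vars N F) m"
      using p by (auto simp: lookup_truncate_vars[OF F] F_eq SymN_le_def in_keys_iff)
  qed
qed

text \<open>\<open>inv_into\<close> selects some preimage; that it truncates back to
  \<open>p\<close> fixes its coefficients in the first \<open>N\<close> variables.\<close>

lemma
  assumes "p \<in> SymN_le d N"
  shows sym_lift_in_Sym_le: "sym_lift d N p \<in> Sym_le d"
    and sym_lift_eq_lookup: "keys m \<subseteq> {..<N} \<Longrightarrow> sym_lift d N p m = lookup p m"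
proof -
  note surj = truncate_vars_surj[OF assms]
  show mem: "sym_lift d N p \<in> Sym_le d"
    unfolding sym_lift_def using surj by (rule inv_into_into)
  have "truncate_vars N (sym_lift d N p) = p"
    unfolding sym_lift_def using surj by (rule f_inv_into_f)
  then show "sym_lift d N p m = lookup p m" if "keys m \<subseteq> {..<N}"
    using lookup_truncate_vars[OF mem, of N m] that by simp
qed

text \<open>Coefficientwise limits are unique. This serves the definite description in
  \<open>I_A\<close>.\<close>

lemma sym_converges_unique:
  assumes "sym_converges f F" "sym_converges f G"
  shows "F = G"
proof
  fix m
  have "\<forall>\<^sub>F d in sequentially. F m = G m"
    using assms[unfolded sym_converges_def, THEN conjunct2]
  proof eventually_elim
    case (elim d)
    then have "(\<lambda>N. sym_lift d N (f N) m) \<longlonglongrightarrow> F m"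
      "(\<lambda>N. sym_lift d N (f N) m) \<longlonglongrightarrow> G m"
      by (simp_all add: limitin_Sym_le_topology)
    then show ?case by (rule LIMSEQ_unique)
  qed
  then show "F m = G m" by simp
qed

text \<open>A monomial involves finitely many variables, so for large \<open>N\<close> its
  coefficient in the lift is the one in \<open>f N\<close>.\<close>

lemma sym_convergesI:
  assumes "F \<in> Sym_le D" and ev: "\<forall>\<^sub>F N in sequentially. f N \<in> SymN_le D N"
    and lim: "\<And>m. (\<lambda>N. lookup (f N) m) \<longlonglongrightarrow> F m"
  shows "sym_converges f F"
  unfolding sym_converges_def
proof
  show "\<exists>D. \<forall>\<^sub>F N in sequentially. f N \<in> SymN_le D N" using ev by blast
  show "\<forall>\<^sub>F d in sequentially.
      limitin (Sym_le_topology d) (\<lambda>N. sym_lift d N (f N)) F sequentially"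
    using eventually_ge_at_top[of D]
  proof eventually_elim
    case (elim d)
    have ev': "\<forall>\<^sub>F N in sequentially. f N \<in> SymN_le d N"
      using ev by eventually_elim (use SymN_le_mono[OF elim] in auto)
    have "(\<lambda>N. sym_lift d N (f N) m) \<longlonglongrightarrow> F m" for m
    proof (rule Lim_transform_eventually[OF lim])
      obtain n where n: "keys m \<subseteq> {..<n}"
        using finite_nat_iff_bounded[of "keys m"] by auto
      show "\<forall>\<^sub>F N in sequentially. lookup (f N) m = sym_lift d N (f N) m"
        using ev' eventually_ge_at_top[of n]
      proof eventually_elim
        case (elim N)
        then have "keys m \<subseteq> {..<N}" using n by auto
        then show ?case using elim by (simp add: sym_lift_eq_lookup)
      qed
    qed
    moreover have "\<forall>\<^sub>F N in sequentially. sym_lift d N (f N) \<in> Sym_le d"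
      using ev' by eventually_elim (simp add: sym_lift_in_Sym_le)
    ultimately show ?case
      using assms(1) Sym_le_mono[OF elim] by (auto simp: limitin_Sym_le_topology)
  qed
qed

section \<open>Substituting a value for one variable\<close>

lemma lookup_single_mult:
  fixes h :: mpolynomial
  shows "lookup (Poly_Mapping.single s z * h) n = (\<Sum>k\<in>keys h. if s + k = n then z * lookup h k else 0)"
proof -
  have "Poly_Mapping.single s z * h =
      Poly_Mapping.single s z * (\<Sum>k\<in>keys h. Poly_Mapping.single k (lookup h k))"
    using poly_mapping_sum_single[of h] by simp
  also have "\<dots> = (\<Sum>k\<in>keys h. Poly_Mapping.single (s + k) (z * lookup h k))"
    by (simp add: sum_distrib_left mult_single)
  finally show ?thesis
    by (simp add: lookup_sum lookup_single when_def)
qed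

lemma lookup_const_mult: "lookup (const z * h) n = z * lookup h n"
  by (simp add: const_def lookup_single_mult in_keys_iff)

lemma lookup_var_mult_0:
  assumes "lookup m i = 0"
  shows "lookup (var i * h) m = 0"
proof -
  have "Poly_Mapping.single i 1 + k \<noteq> m" for k
    using assms by (auto simp: lookup_add)
  then show ?thesis by (simp add: var_def lookup_single_mult)
qed

lemma lookup_var_mult_Suc:
  "lookup (var i * h) (m + Poly_Mapping.single i (Suc k)) = lookup h (m + Poly_Mapping.single i k)"
proof -
  have "Poly_Mapping.single i (Suc k) = Poly_Mapping.single i 1 + Poly_Mapping.single i k"
    by (simp add: single_add[symmetric])
  then have "Poly_Mapping.single i 1 + l = m + Poly_Mapping.single i (Suc k) \<longleftrightarrow>
      l = m + Poly_Mapping.single i k" for l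
    by (metis add.left_commute add_left_cancel)
  then show ?thesis by (simp add: var_def lookup_single_mult in_keys_iff)
qed

text \<open>The functional \<open>f \<mapsto> \<Sum>\<^sub>k z\<^sup>k [x\<^sup>m x\<^sub>N\<^sup>k] f\<close>, i.e. substitution of \<open>z\<close> for \<open>x\<^sub>N\<close> followed by
  extraction of a coefficient, vanishes on the ideal generated by \<open>x\<^sub>N - z\<close>.\<close>

lemma sum_lookup_eq_0_if_dvd:
  assumes dvd: "(var N - const z) dvd f" and m: "lookup m N = 0"
    and D: "\<And>k. D < k \<Longrightarrow> lookup f (m + Poly_Mapping.single N k) = 0"
  shows "(\<Sum>k\<le>D. z ^ k * lookup f (m + Poly_Mapping.single N k)) = 0"
proof -
  let ?e = "\<lambda>k. m + Poly_Mapping.single N k"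
  obtain h where h: "f = (var N - const z) * h" using dvd by (auto elim: dvdE)
  \<comment> \<open>The coefficient of \<open>f\<close> at \<open>?e (Suc K)\<close> is
    \<open>lookup h (?e K) - z * lookup h (?e (Suc K))\<close>, so the sum telescopes to a boundary
    term.\<close>
  have partial: "(\<Sum>k\<le>K. z ^ k * lookup f (?e k)) = - (z ^ Suc K * lookup h (?e K))" for K
  proof (induction K)
    case 0
    then show ?case
      using lookup_var_mult_0[OF m, of h]
      by (simp add: h left_diff_distrib lookup_minus lookup_const_mult)
  next
    case (Suc K)
    have "lookup f (?e (Suc K)) = lookup h (?e K) - z * lookup h (?e (Suc K))"
      by (simp add: h left_diff_distrib lookup_minus lookup_const_mult lookup_var_mult_Suc)
    then show ?case by (simp add: Suc.IH right_diff_distrib mult.assoc)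
  qed
  \<comment> \<open>\<open>h\<close> has finite support, so the boundary term vanishes far out. The
    cutoff \<open>D + B\<close> lies beyond that support, and the terms it adds after
    \<open>D\<close> are zero.\<close>
  have "finite (?e -` keys h)"
  proof (intro finite_vimageI injI finite_keys)
    fix k l assume "?e k = ?e l"
    then have "lookup (?e k) N = lookup (?e l) N" by simp
    then show "k = l" by (simp only: lookup_add lookup_single_eq add_left_cancel)
  qed
  then obtain B where B: "\<And>k. k \<in> ?e -` keys h \<Longrightarrow> k < B"
    unfolding finite_nat_iff_bounded by auto
  have "lookup h (?e (D + B)) = 0"
    using B[of "D + B"] by (auto simp: in_keys_iff)
  then have "0 = (\<Sum>k\<le>D + B. z ^ k * lookup f (?e k))"
    using partial[of "D + B"] by simp
  also have "\<dots> = (\<Sum>k\<le>D. z ^ k * lookup f (?e k))"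
    by (rule sum.mono_neutral_right) (auto simp: D)
  finally show ?thesis ..
qed

section \<open>Coefficient bounds and limits of stable sequences\<close>

definition max_coeff :: "mpolynomial \<Rightarrow> real" where
  "max_coeff p = Max (insert 0 ((\<lambda>m. norm (lookup p m)) ` keys p))"

lemma max_coeff_nonneg: "0 \<le> max_coeff p"
  unfolding max_coeff_def by (rule Max_ge) auto

lemma norm_lookup_le_max_coeff: "norm (lookup p m) \<le> max_coeff p"
proof (cases "m \<in> keys p")
  case True
  then show ?thesis unfolding max_coeff_def by (intro Max_ge) auto
qed (simp add: in_keys_iff max_coeff_nonneg)

lemma max_coeff_le:
  "0 \<le> B \<Longrightarrow> (\<And>m. m \<in> keys p \<Longrightarrow> norm (lookup p m) \<le> B) \<Longrightarrow> max_coeff p \<le> B"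
  unfolding max_coeff_def by (subst Max_le_iff) auto

context
  fixes p :: "nat \<Rightarrow> mpolynomial" and z :: "nat \<Rightarrow> complex" and D N0 :: nat
  assumes mem: "\<And>N. N0 \<le> N \<Longrightarrow> p N \<in> SymN_le D N"
    and dvd: "\<And>N. N0 \<le> N \<Longrightarrow> (var N - const (z N)) dvd p (Suc N) - p N"
    and summable: "summable (\<lambda>N. norm (z N))"
begin

text \<open>In the vanishing functional the term \<open>k = 0\<close> is the coefficient difference.
  The terms \<open>0 < k \<le> D\<close> come from \<open>p (Suc N)\<close> alone, since
  \<open>var N\<close> does not occur in \<open>p N\<close>, and each carries a factor
  \<open>z N\<close>.\<close>

lemma stable_coeff_diff:
  assumes N: "N0 \<le> N" and z: "norm (z N) \<le> 1" and m: "lookup m N = 0"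
  shows "norm (lookup (p (Suc N)) m - lookup (p N) m) \<le> D * norm (z N) * max_coeff (p (Suc N))"
proof -
  let ?e = "\<lambda>k. m + Poly_Mapping.single N k"
  have p_N: "lookup (p N) (?e k) = 0" if "0 < k" for k
  proof -
    have "N \<in> keys (?e k)" using that by (simp add: in_keys_iff lookup_add)
    then have "\<not> keys (?e k) \<subseteq> {..<N}" by auto
    then have "?e k \<notin> keys (p N)" using mem[OF N] unfolding SymN_le_def by blast
    then show ?thesis by (simp add: in_keys_iff)
  qed
  have deg: "lookup (p (Suc N)) (?e k) = 0" if "D < k" for k
  proof (rule ccontr)
    assume "lookup (p (Suc N)) (?e k) \<noteq> 0"
    then have "mdeg (?e k) \<le> D"
      using mem[of "Suc N"] N unfolding SymN_le_def deg_le_def by simp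
    then show False using that by (simp add: mdeg_add)
  qed
  let ?T = "\<Sum>k<D. z N ^ Suc k * lookup (p (Suc N)) (?e (Suc k))"
  have "(\<Sum>k\<le>D. z N ^ k * lookup (p (Suc N) - p N) (?e k)) = 0"
    by (rule sum_lookup_eq_0_if_dvd[OF dvd[OF N] m]) (simp add: lookup_minus p_N deg)
  moreover have "(\<Sum>k\<le>D. z N ^ k * lookup (p (Suc N) - p N) (?e k)) =
      lookup (p (Suc N)) m - lookup (p N) m + ?T"
    by (subst sum.atMost_shift) (simp add: lookup_minus p_N)
  ultimately have "lookup (p (Suc N)) m - lookup (p N) m = - ?T"
    by (simp add: add_eq_0_iff2)
  moreover have "norm ?T \<le> (\<Sum>k<D. norm (z N) * max_coeff (p (Suc N)))"
  proof (rule sum_norm_le)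
    fix k
    have "norm (z N) ^ k \<le> 1" using z by (simp add: power_le_one)
    then have "norm (z N) ^ Suc k \<le> norm (z N)"
      using mult_left_mono[of "norm (z N) ^ k" 1 "norm (z N)"] by simp
    then show "norm (z N ^ Suc k * lookup (p (Suc N)) (?e (Suc k))) \<le>
        norm (z N) * max_coeff (p (Suc N))"
      unfolding norm_mult norm_power by (intro mult_mono norm_lookup_le_max_coeff) auto
  qed
  ultimately show ?thesis by simp
qed

text \<open>By symmetry the largest coefficient of \<open>p\<^sub>N\<^sub>+\<^sub>1\<close> occurs at a monomial not involving \<open>x\<^sub>N\<close>.\<close>

lemma max_coeff_Suc_le:
  assumes N: "N0 \<le> N" "D \<le> N" and z: "norm (z N) \<le> 1"
  shows "max_coeff (p (Suc N)) \<le> max_coeff (p N) + D * norm (z N) * max_coeff (p (Suc N))"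
proof (rule max_coeff_le)
  show "0 \<le> max_coeff (p N) + D * norm (z N) * max_coeff (p (Suc N))"
    by (simp add: max_coeff_nonneg)
  fix m assume m: "m \<in> keys (p (Suc N))"
  have sym: "p (Suc N) \<in> SymN_le D (Suc N)" using mem[of "Suc N"] N by simp
  have keys: "keys m \<subseteq> {..<Suc N}" and "mdeg m \<le> D"
    using sym m by (auto simp: SymN_le_def deg_le_def in_keys_iff)
  \<comment> \<open>At most \<open>D \<le> N\<close> of the \<open>N + 1\<close> variables occur in
    \<open>m\<close>; a missing one is exchanged with \<open>var N\<close>.\<close>
  have "card (keys m) < Suc N"
    using card_keys_le_mdeg[of m] \<open>mdeg m \<le> D\<close> N by simp
  then obtain i where i: "i < Suc N" "i \<notin> keys m"
    using keys by (metis card_lessThan finite_keys card_mono lessThan_iff linorder_not_less subsetI)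
  define m' where "m' = map_key (transpose i N) m"
  have \<pi>: "transpose i N permutes {..<Suc N}"
    using i by (intro permutes_swap_id) auto
  have "lookup (p (Suc N)) m' = lookup (p (Suc N)) m"
    using sym \<pi> by (simp add: SymN_le_def perm_invariant_def m'_def)
  moreover have "lookup m' N = 0"
    using i permutes_inj[OF \<pi>] by (simp add: m'_def lookup_map_key in_keys_iff)
  moreover have "norm (lookup (p (Suc N)) m') \<le>
      norm (lookup (p N) m') + norm (lookup (p (Suc N)) m' - lookup (p N) m')"
    by (metis add.commute diff_add_cancel norm_triangle_ineq)
  ultimately show "norm (lookup (p (Suc N)) m) \<le>
      max_coeff (p N) + D * norm (z N) * max_coeff (p (Suc N))"
    using stable_coeff_diff[OF N(1) z, of m'] norm_lookup_le_max_coeff[of "p N" m'] by simp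
qed

text \<open>With \<open>x = D * norm (z N)\<close> the previous estimate reads
  \<open>max_coeff (p (Suc N)) * (1 - x) \<le> max_coeff (p N)\<close>, and
  \<open>1 / (1 - x) \<le> 1 + 2 * x \<le> exp (2 * x)\<close> for small \<open>x\<close>. The
  product of these factors stays bounded by absolute summability.\<close>

lemma max_coeff_bounded: "\<exists>N1 B. \<forall>N\<ge>N1. max_coeff (p N) \<le> B"
proof -
  have "(\<lambda>N. D * norm (z N)) \<longlonglongrightarrow> real D * 0"
    by (intro tendsto_mult tendsto_const summable_LIMSEQ_zero summable)
  then have "\<forall>\<^sub>F N in sequentially. D * norm (z N) < 1/2"
    by (rule order_tendstoD) simp
  moreover have "\<forall>\<^sub>F N in sequentially. norm (z N) < 1"
    using summable_LIMSEQ_zero[OF summable] by (rule order_tendstoD) simp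
  ultimately have "\<forall>\<^sub>F N in sequentially. D * norm (z N) < 1/2 \<and> norm (z N) < 1 \<and> N0 \<le> N \<and> D \<le> N"
    using eventually_ge_at_top[of N0] eventually_ge_at_top[of D]
    by eventually_elim auto
  then obtain N1 where N1: "\<And>N. N1 \<le> N \<Longrightarrow>
      D * norm (z N) < 1/2 \<and> norm (z N) < 1 \<and> N0 \<le> N \<and> D \<le> N"
    unfolding eventually_sequentially by blast
  let ?S = "\<lambda>N. \<Sum>i<N. norm (z i)"
  have growth: "max_coeff (p (Suc N)) \<le> max_coeff (p N) * exp (2 * D * norm (z N))" if "N1 \<le> N" for N
  proof -
    let ?x = "D * norm (z N)"
    have "max_coeff (p (Suc N)) * (1 - ?x) \<le> max_coeff (p N)"
      using max_coeff_Suc_le[of N] N1[OF that] by (simp add: algebra_simps)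
    then have "max_coeff (p (Suc N)) * (1 - ?x) * (1 + 2 * ?x) \<le> max_coeff (p N) * (1 + 2 * ?x)"
      by (rule mult_right_mono) simp
    moreover have "max_coeff (p (Suc N)) * 1 \<le> max_coeff (p (Suc N)) * ((1 - ?x) * (1 + 2 * ?x))"
    proof (rule mult_left_mono[OF _ max_coeff_nonneg])
      \<comment> \<open>This is \<open>(1 - x) * (1 + 2 * x) - 1\<close>; the threshold 1/2 makes it
        nonnegative.\<close>
      have "0 \<le> ?x * (1 - 2 * ?x)" using N1[OF that] by (intro mult_nonneg_nonneg) auto
      then show "1 \<le> (1 - ?x) * (1 + 2 * ?x)" by (simp add: algebra_simps)
    qed
    moreover have "max_coeff (p N) * (1 + 2 * ?x) \<le> max_coeff (p N) * exp (2 * D * norm (z N))"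
      using exp_ge_add_one_self[of "2 * ?x"]
      by (intro mult_left_mono max_coeff_nonneg) (simp add: mult.assoc)
    ultimately show ?thesis by (simp add: mult.assoc)
  qed
  have bound: "max_coeff (p N) \<le> max_coeff (p N1) * exp (2 * D * (?S N - ?S N1))" if "N1 \<le> N" for N
    using that
  proof (induction N rule: dec_induct)
    case (step N)
    have "max_coeff (p (Suc N)) \<le>
        max_coeff (p N1) * exp (2 * D * (?S N - ?S N1)) * exp (2 * D * norm (z N))"
      using \<open>N1 \<le> N\<close> step.IH by (intro order_trans[OF growth] mult_right_mono) auto
    then show ?case by (simp add: exp_add[symmetric] algebra_simps)
  qed simp
  have "max_coeff (p N) \<le> max_coeff (p N1) * exp (2 * D * suminf (\<lambda>i. norm (z i)))" if "N1 \<le> N" for N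
  proof -
    have "?S N \<le> suminf (\<lambda>i. norm (z i))"
      using summable by (rule sum_le_suminf) auto
    moreover have "0 \<le> ?S N1" by (rule sum_nonneg) auto
    ultimately have "?S N - ?S N1 \<le> suminf (\<lambda>i. norm (z i))" by linarith
    then show ?thesis
      by (intro order_trans[OF bound[OF that]] mult_left_mono max_coeff_nonneg)
        (auto intro!: mult_left_mono)
  qed
  then show ?thesis by blast
qed

text \<open>Once \<open>N\<close> exceeds all variable indices in \<open>m\<close>, the increments
  are at most a constant times \<open>norm (z N)\<close>, so the telescoping series
  converges.\<close>

lemma stable_coeff_convergent: "convergent (\<lambda>N. lookup (p N) m)"
proof -
  let ?f = "\<lambda>N. lookup (p N) m"
  obtain N1 B where B: "\<And>N. N1 \<le> N \<Longrightarrow> max_coeff (p N) \<le> B"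
    using max_coeff_bounded by blast
  obtain n where n: "keys m \<subseteq> {..<n}"
    using finite_nat_iff_bounded[of "keys m"] by auto
  have "\<forall>\<^sub>F N in sequentially. norm (z N) < 1"
    using summable_LIMSEQ_zero[OF summable] by (rule order_tendstoD) simp
  then have "\<forall>\<^sub>F N in sequentially. norm (?f (Suc N) - ?f N) \<le> norm (z N) * (D * B)"
    using eventually_ge_at_top[of N0] eventually_ge_at_top[of N1] eventually_ge_at_top[of n]
  proof eventually_elim
    case (elim N)
    have "N \<notin> keys m" using n elim by auto
    then have "norm (?f (Suc N) - ?f N) \<le> D * norm (z N) * max_coeff (p (Suc N))"
      using elim by (intro stable_coeff_diff) (auto simp: in_keys_iff)
    also have "\<dots> \<le> D * norm (z N) * B"
      using B[of "Suc N"] elim by (intro mult_left_mono) auto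
    finally show ?case by (simp add: mult_ac)
  qed
  then have "summable (\<lambda>N. ?f (Suc N) - ?f N)"
    by (rule summable_comparison_test_ev) (intro summable_mult2 summable)
  then have "convergent (\<lambda>n. (\<Sum>N<n. ?f (Suc N) - ?f N) + ?f 0)"
    unfolding summable_iff_convergent by (intro convergent_add convergent_const)
  moreover have "(\<Sum>N<n. ?f (Suc N) - ?f N) + ?f 0 = ?f n" for n
    by (induction n) (auto simp: algebra_simps)
  ultimately show ?thesis by (simp only:)
qed

text \<open>Symmetry and the degree bound are conditions on coefficients that hold for all large
  \<open>N\<close> and pass to the limit.\<close>

lemma stable_sym_converges: "\<exists>F\<in>Sym_le D. sym_converges p F"
proof
  define F where "F m = lim (\<lambda>N. lookup (p N) m)" for m
  have lim: "(\<lambda>N. lookup (p N) m) \<longlonglongrightarrow> F m" for m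
    unfolding F_def using stable_coeff_convergent by (rule convergent_LIMSEQ_iff[THEN iffD1])
  have ev: "\<forall>\<^sub>F N in sequentially. p N \<in> SymN_le D N"
    using eventually_ge_at_top[of N0] by eventually_elim (rule mem)
  have "F (map_key \<pi> m) = F m" if \<pi>: "\<pi> permutes {..<n}" for \<pi> n m
  proof (rule LIMSEQ_unique[OF lim])
    have "\<forall>\<^sub>F N in sequentially. lookup (p N) m = lookup (p N) (map_key \<pi> m)"
      using ev eventually_ge_at_top[of n]
    proof eventually_elim
      case (elim N)
      then have "\<pi> permutes {..<N}" using \<pi> by (auto intro: permutes_subset)
      then show ?case using elim by (simp add: SymN_le_def perm_invariant_def)
    qed
    then show "(\<lambda>N. lookup (p N) (map_key \<pi> m)) \<longlonglongrightarrow> F m"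
      by (rule Lim_transform_eventually[OF lim])
  qed
  moreover have "mdeg m \<le> D" if "F m \<noteq> 0" for m
  proof (rule ccontr)
    assume "\<not> mdeg m \<le> D"
    then have "\<forall>\<^sub>F N in sequentially. lookup (p N) m = 0"
      by (intro eventually_mono[OF ev]) (auto simp: SymN_le_def deg_le_def)
    then have "(\<lambda>N. 0) \<longlonglongrightarrow> F m"
      by (rule Lim_transform_eventually[OF lim])
    then show False using that LIMSEQ_unique tendsto_const by metis
  qed
  ultimately show "F \<in> Sym_le D"
    by (auto simp: Sym_le_def perm_invariant_def deg_le_def)
  then show "sym_converges p F"
    using ev lim by (rule sym_convergesI)
qed

end

section \<open>Interpolation symmetric functions\<close>

lemma partition_support:
  assumes "is_partition mu"
  shows "{i. mu i \<noteq> 0} = {..<plength mu}"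
proof -
  have fin: "finite {i. mu i \<noteq> 0}" and anti: "antimono mu"
    using assms by (auto simp: is_partition_def)
  define L where "L = (LEAST i. mu i = 0)"
  have "mu L = 0"
    unfolding L_def using ex_new_if_finite[OF infinite_UNIV_nat fin] by (auto intro: LeastI)
  have "mu i \<noteq> 0 \<longleftrightarrow> i < L" for i
  proof
    assume "mu i \<noteq> 0"
    then show "i < L"
      using antimonoD[OF anti, of L i] \<open>mu L = 0\<close> by (cases "i < L") auto
  next
    assume "i < L"
    then show "mu i \<noteq> 0" unfolding L_def by (rule not_less_Least)
  qed
  then have "{i. mu i \<noteq> 0} = {..<L}" by auto
  then show ?thesis by (simp add: plength_def)
qed

lemma partition_eq_0:
  assumes "is_partition mu" "plength mu \<le> i"
  shows "mu i = 0"
proof (rule ccontr)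
  assume "mu i \<noteq> 0"
  then have "i \<in> {..<plength mu}"
    by (subst partition_support[OF assms(1), symmetric]) simp
  then show False using assms(2) by simp
qed

lemma plength_mono:
  assumes "is_partition mu" "is_partition lam" "mu \<le> lam"
  shows "plength mu \<le> plength lam"
proof -
  have "{i. mu i \<noteq> 0} \<subseteq> {i. lam i \<noteq> 0}"
    using le_funD[OF assms(3)] by (metis (mono_tags) le_zero_eq mem_Collect_eq subsetI)
  then show ?thesis
    unfolding partition_support[OF assms(1)] partition_support[OF assms(2)] by simp
qed

lemma psize_eq_sum:
  assumes "is_partition mu" "plength mu \<le> L"
  shows "psize mu = (\<Sum>i<L. mu i)"
  unfolding psize_def partition_support[OF assms(1)]
  using assms by (intro sum.mono_neutral_left) (auto simp: partition_eq_0)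

lemma pn_eq_sum:
  assumes "is_partition mu" "plength mu \<le> L"
  shows "pn mu = (\<Sum>i<L. i * mu i)"
  unfolding pn_def partition_support[OF assms(1)]
  using assms by (intro sum.mono_neutral_left) (auto simp: partition_eq_0)

lemma psize_mono:
  assumes "is_partition mu" "is_partition lam" "mu \<le> lam"
  shows "psize mu \<le> psize lam"
  unfolding psize_eq_sum[OF assms(1) plength_mono[OF assms]] psize_eq_sum[OF assms(2) order_refl]
  using assms(3) by (intro sum_mono) (simp add: le_fun_def)

text \<open>Exchanging the sums over rows and columns leaves, for row \<open>i\<close>, the sum of
  all \<open>j < mu i\<close>. Doubling avoids a division.\<close>

lemma pn_ptranspose:
  assumes "is_partition mu" "plength mu \<le> L"
  shows "2 * int (pn (ptranspose mu)) = (\<Sum>i<L. int (mu i) * (int (mu i) - 1))"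
proof -
  \<comment> \<open>\<open>M\<close> bounds every part, so one finite range of columns serves all
    rows.\<close>
  define M where "M = (\<Sum>i<L. mu i)"
  have M: "mu i \<le> M" if "i < L" for i
    unfolding M_def using that by (intro member_le_sum) auto
  have pt: "ptranspose mu j = (\<Sum>i<L. if j < mu i then 1 else 0)" for j
  proof -
    have "{i. j < mu i} = {i \<in> {..<L}. j < mu i}"
      using assms partition_eq_0[of mu] by (metis (mono_tags, lifting) lessThan_iff
          linorder_not_less not_less_zero order_trans)
    also have "\<dots> = {..<L} \<inter> {i. j < mu i}" by auto
    finally show ?thesis by (simp add: ptranspose_def sum.If_cases)
  qed
  have "pn (ptranspose mu) = (\<Sum>j<M. j * ptranspose mu j)"
    unfolding pn_def
  proof (rule sum.mono_neutral_left)
    show "{j. ptranspose mu j \<noteq> 0} \<subseteq> {..<M}"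
      using M by (auto simp: pt split: if_splits) (meson less_le_trans)
  qed auto
  also have "\<dots> = (\<Sum>j<M. \<Sum>i<L. if j < mu i then j else 0)"
    by (simp add: pt sum_distrib_left if_distrib cong: if_cong)
  also have "\<dots> = (\<Sum>i<L. \<Sum>j<M. if j < mu i then j else 0)"
    by (rule sum.swap)
  also have "\<dots> = (\<Sum>i<L. \<Sum>j<mu i. j)"
  proof (rule sum.cong[OF refl])
    fix i assume "i \<in> {..<L}"
    then have "{..<M} \<inter> {j. j < mu i} = {..<mu i}" using M[of i] by auto
    then show "(\<Sum>j<M. if j < mu i then j else 0) = (\<Sum>j<mu i. j)"
      by (simp add: sum.If_cases)
  qed
  finally have "int (pn (ptranspose mu)) = (\<Sum>i<L. \<Sum>j<mu i. int j)" by simp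
  moreover have "2 * (\<Sum>j<k. int j) = int k * (int k - 1)" for k
    by (induction k) (auto simp: algebra_simps)
  ultimately show ?thesis by (simp add: sum_distrib_left)
qed

text \<open>The polynomials form a stable sequence with \<open>z N = q ^ N\<close>: passing from
  \<open>N\<close> to \<open>N + 1\<close> variables prepends \<open>q ^ N\<close> to the parameters
  \<open>q ^ (N - 1), q ^ (N - 2), ...\<close>.\<close>

lemma I_A_in_Sym_le:
  assumes mu: "is_partition mu" and q: "norm q < 1" "q \<noteq> 0"
  shows "I_A mu q \<in> Sym_le (psize mu)"
proof -
  let ?c = "\<lambda>N i. q powi (int N - 1 - int i)"
  let ?p = "\<lambda>N. interp_schur mu N (?c N)"
  have mem: "?p N \<in> SymN_le (psize mu) N" if "plength mu \<le> N" for N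
    unfolding interp_schur_eq
    by (rule interp_det_SymN_le) (simp add: psize_eq_sum[OF mu that])
  have dvd: "(var N - const (q ^ N)) dvd ?p (Suc N) - ?p N" if "plength mu \<le> N" for N
  proof -
    have "?c (Suc N) \<circ> Suc = ?c N" by (auto simp: fun_eq_iff algebra_simps)
    moreover have "?c (Suc N) 0 = q ^ N" by simp
    ultimately show ?thesis
      using interp_det_Suc_cong[of mu N "?c (Suc N)"] partition_eq_0[OF mu that]
      by (simp only: interp_schur_eq)
  qed
  have "summable (\<lambda>N. norm (q ^ N))"
    using q by (simp add: norm_power summable_geometric)
  then obtain F where F: "F \<in> Sym_le (psize mu)" "sym_converges ?p F"
    using stable_sym_converges[of "plength mu" ?p "psize mu" "\<lambda>N. q ^ N"] mem dvd by blast
  have "I_A mu q = F"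
    unfolding I_A_def using F(2) sym_converges_unique by blast
  then show ?thesis using F(1) by simp
qed

lemma scale_vars_in_Sym_le: "F \<in> Sym_le d \<Longrightarrow> scale_vars c F \<in> Sym_le d"
  by (auto simp: Sym_le_def perm_invariant_def deg_le_def scale_vars_def mdeg_map_key permutes_bij)

lemma sum_in_Sym_le:
  assumes "\<And>i. i \<in> I \<Longrightarrow> F i \<in> Sym_le d"
  shows "(\<lambda>m. \<Sum>i\<in>I. s i * F i m) \<in> Sym_le d"
proof -
  have "(\<Sum>i\<in>I. s i * F i (map_key \<pi> m)) = (\<Sum>i\<in>I. s i * F i m)" if "\<pi> permutes {..<n}" for \<pi> n m
    using assms that by (intro sum.cong) (auto simp: Sym_le_def perm_invariant_def)
  moreover have "mdeg m \<le> d" if "(\<Sum>i\<in>I. s i * F i m) \<noteq> 0" for m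
  proof -
    obtain i where "i \<in> I" "s i * F i m \<noteq> 0" using \<open>_ \<noteq> 0\<close> by (rule sum.not_neutral_contains_not_neutral)
    then show ?thesis using assms[of i] by (auto simp: Sym_le_def deg_le_def)
  qed
  ultimately show ?thesis by (auto simp: Sym_le_def perm_invariant_def deg_le_def)
qed

lemma scaled_I_A_in_Sym_le:
  assumes "is_partition lam" "is_partition mu" "mu \<le> lam" "norm q < 1" "q \<noteq> 0"
  shows "scale_vars c (I_A mu q) \<in> Sym_le (psize lam)"
  using scale_vars_in_Sym_le[OF I_A_in_Sym_le[of mu q]] Sym_le_mono[OF psize_mono[of mu lam]] assms
  by blast

section \<open>The limit of the coefficients\<close>

lemma det1_eq_sum:
  "det1 n h = (\<Sum>p | p permutes {0..<n}. signof p * (\<Prod>i = 0..<n. h (Suc i) (Suc (p i))))"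
proof -
  have "p i < n" if "p permutes {0..<n}" "i < n" for p i
    using permutes_in_image[OF that(1), of i] that(2) by simp
  then show ?thesis unfolding det1_def
    by (subst det_def'[of _ n]) (auto intro!: sum.cong prod.cong)
qed

lemma tendsto_det1:
  fixes f :: "'b \<Rightarrow> nat \<Rightarrow> nat \<Rightarrow> 'a :: {comm_ring_1, real_normed_field}"
  assumes "\<And>j k. 1 \<le> j \<Longrightarrow> j \<le> n \<Longrightarrow> 1 \<le> k \<Longrightarrow> k \<le> n \<Longrightarrow> ((\<lambda>x. f x j k) \<longlongrightarrow> g j k) G"
  shows "((\<lambda>x. det1 n (f x)) \<longlongrightarrow> det1 n g) G"
proof -
  have "((\<lambda>x. \<Sum>p | p permutes {0..<n}. signof p * (\<Prod>i = 0..<n. f x (Suc i) (Suc (p i)))) \<longlongrightarrow>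
      (\<Sum>p | p permutes {0..<n}. signof p * (\<Prod>i = 0..<n. g (Suc i) (Suc (p i))))) G"
  proof (intro tendsto_sum tendsto_mult tendsto_const tendsto_prod)
    fix p i assume "p \<in> {p. p permutes {0..<n}}" "i \<in> {0..<n}"
    then have "p i < n" "i < n" using permutes_in_image[of p "{0..<n}" i] by auto
    then show "((\<lambda>x. f x (Suc i) (Suc (p i))) \<longlongrightarrow> g (Suc i) (Suc (p i))) G"
      by (intro assms) auto
  qed
  then show ?thesis by (simp only: det1_eq_sum)
qed

text \<open>Each Leibniz term contains every row factor and every column factor exactly
  once.\<close>

lemma det1_mult_rows_columns:
  fixes r s :: "nat \<Rightarrow> 'a :: comm_ring_1"
  shows "det1 n (\<lambda>j k. r j * s k * f j k) = (\<Prod>i<n. r (Suc i) * s (Suc i)) * det1 n f"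
proof -
  have "(\<Prod>i = 0..<n. r (Suc i) * s (Suc (p i)) * f (Suc i) (Suc (p i))) =
      (\<Prod>i<n. r (Suc i) * s (Suc i)) * (\<Prod>i = 0..<n. f (Suc i) (Suc (p i)))"
    if p: "p permutes {0..<n}" for p
    using prod.permute[OF p, of "\<lambda>i. s (Suc i)"]
    by (simp add: prod.distrib comp_def atLeast0LessThan)
  then show ?thesis
    by (simp add: det1_eq_sum sum_distrib_left mult.left_commute)
qed

text \<open>Clearing \<open>b\<close> turns each quotient of factors into
  \<open>(b - x * q ^ k) / (b - y * q ^ k)\<close>, which is continuous at 0 with value
  \<open>x / y\<close>.\<close>

lemma qpoch_ratio_tendsto:
  fixes x y q :: complex
  assumes "y \<noteq> 0" "q \<noteq> 0"
  shows "((\<lambda>b::real. qpoch (x / of_real b) q n / qpoch (y / of_real b) q n) \<longlongrightarrow> (x / y) ^ n)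
    (at 0 within S)"
proof (rule Lim_transform_eventually)
  have "((\<lambda>b::real. \<Prod>k<n. (of_real b - x * q ^ k) / (of_real b - y * q ^ k)) \<longlongrightarrow>
      (\<Prod>k<n. (of_real 0 - x * q ^ k) / (of_real 0 - y * q ^ k))) (at 0 within S)"
    using assms by (intro tendsto_intros) auto
  then show "((\<lambda>b::real. \<Prod>k<n. (of_real b - x * q ^ k) / (of_real b - y * q ^ k)) \<longlongrightarrow>
      (x / y) ^ n) (at 0 within S)"
    using assms by simp
  show "\<forall>\<^sub>F b in at (0::real) within S.
      (\<Prod>k<n. (of_real b - x * q ^ k) / (of_real b - y * q ^ k)) =
      qpoch (x / of_real b) q n / qpoch (y / of_real b) q n"
    unfolding eventually_at_filter
  proof (intro always_eventually allI impI)
    fix b :: real assume "b \<noteq> 0"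
    \<comment> \<open>For \<open>b = v\<close> both sides are 0 by the convention on division by
      zero.\<close>
    have "(of_real b - w) / (of_real b - v) = (1 - w / of_real b) / (1 - v / of_real b)" for v w
      :: complex
    proof -
      have "1 - w / of_real b = (of_real b - w) / of_real b" for w :: complex
        using \<open>b \<noteq> 0\<close> by (simp add: diff_divide_distrib)
      then show ?thesis using \<open>b \<noteq> 0\<close> by simp
    qed
    then show "(\<Prod>k<n. (of_real b - x * q ^ k) / (of_real b - y * q ^ k)) =
        qpoch (x / of_real b) q n / qpoch (y / of_real b) q n"
      by (simp add: qpoch_def prod_dividef)
  qed
qed

lemma prod_power_int:
  fixes x :: "'a :: field"
  assumes "x \<noteq> 0" shows "(\<Prod>i\<in>I. x powi f i) = x powi (\<Sum>i\<in>I. f i)"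
  by (induction I rule: infinite_finite_induct) (auto simp: power_int_add assms)

section \<open>Limit of a single entry and the resulting prefactor\<close>

context
  fixes a c d q :: complex
  assumes nonzero: "a \<noteq> 0" "c \<noteq> 0" "d \<noteq> 0" "q \<noteq> 0"
begin

text \<open>\<open>row_factor L\<close> and \<open>column_factor U\<close> with \<open>L = \<lambda>\<^sub>j - j\<close> and \<open>U = \<mu>\<^sub>k - k\<close>: in the limit the
  \<open>b\<close>-dependent quotient of an entry becomes \<open>(a/d)\<^sup>e\<close> times the power of \<open>q\<close> with exponent
  \<open>- e (L + U + 2)\<close>, and with \<open>e = L - U\<close> this factors because \<open>e (L + U + 2) = (L\<^sup>2 + 2 L) - (U\<^sup>2 + 2 U)\<close>.\<close>

definition row_factor :: "int \<Rightarrow> complex" where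
  "row_factor L = (a / d) powi L * q powi (- (L * L + 2 * L))"

definition column_factor :: "int \<Rightarrow> complex" where
  "column_factor U = (a / d) powi (- U) * q powi (U * U + 2 * U)"

lemma row_column_factor:
  "row_factor L * column_factor U =
     (a / d) powi (L - U) * q powi (- ((L - U) * (L + U + 2)))"
proof -
  have "(a / d) powi (L - U) = (a / d) powi L * (a / d) powi (- U)"
    using nonzero power_int_add[of "a / d" L "- U"] by simp
  moreover have "- ((L - U) * (L + U + 2)) = - (L * L + 2 * L) + (U * U + 2 * U)"
    by (simp add: algebra_simps)
  then have "q powi (- ((L - U) * (L + U + 2))) = q powi (- (L * L + 2 * L)) * q powi (U * U + 2 * U)"
    using nonzero power_int_add[of q "- (L * L + 2 * L)" "U * U + 2 * U"] by simp
  ultimately show ?thesis by (simp add: row_factor_def column_factor_def)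
qed

lemma sigma_entry_tendsto:
  fixes l u j k :: int
  assumes e: "e = l - j - u + k" "0 \<le> e"
  shows "((\<lambda>b::real.
      qpoch (c / a * q powi (u + 2 - k)) q (nat e) *
      qpoch (c / of_real b * q powi (u + 2 - k)) q (nat e) /
      (q powi ((u + 1 - k) * e) *
       (qpoch q q (nat e) *
        qpoch (c * d / (a * of_real b) * q powi (l + u + 3 - j - k)) q (nat e)))) \<longlongrightarrow>
      row_factor (l - j) * column_factor (u - k) *
      (qpoch (c / a * q powi (u + 2 - k)) q (nat e) / qpoch q q (nat e))) (at 0 within S)"
proof -
  \<comment> \<open>\<open>x / b\<close> and \<open>y / b\<close> are the arguments of the two
    factorials depending on \<open>b\<close>. With \<open>L = l - j\<close> and
    \<open>U = u - k\<close>, the limit contributes the exponent \<open>- (L + 1) * e\<close> of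
    \<open>q\<close> and the denominator \<open>- (U + 1) * e\<close>.\<close>
  define x where "x = c * q powi (u + 2 - k)"
  define y where "y = c * d / a * q powi (l + u + 3 - j - k)"
  let ?P = "qpoch (c / a * q powi (u + 2 - k)) q (nat e)"
  let ?C = "?P / (q powi ((u + 1 - k) * e) * qpoch q q (nat e))"
  have "y \<noteq> 0" using nonzero by (simp add: y_def)
  have "x / y = a / d * (q powi (u + 2 - k) / q powi (l + u + 3 - j - k))"
    using nonzero by (simp add: x_def y_def field_simps)
  also have "q powi (u + 2 - k) / q powi (l + u + 3 - j - k) = q powi (- (l - j + 1))"
    using nonzero by (simp add: power_int_diff[symmetric])
  finally have xy: "x / y = a / d * q powi (- (l - j + 1))" .
  have "(x / y) ^ nat e = (a / d) powi e * q powi (- (l - j + 1) * e)"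
    using e(2) unfolding xy power_mult_distrib
    by (simp add: power_int_mult power_int_def[of _ e])
  moreover have "q powi (- (l - j + 1) * e) / q powi ((u + 1 - k) * e) =
      q powi (- (e * (l - j + (u - k) + 2)))"
    using nonzero by (simp add: power_int_diff[symmetric] algebra_simps)
  moreover have "p / (v * r) * (f * w) = f * (w / v) * (p / r)" for p v r f w :: complex
    by (simp add: divide_inverse mult_ac)
  moreover have "l - j - (u - k) = e" using e(1) by simp
  ultimately have lim: "?C * (x / y) ^ nat e =
      row_factor (l - j) * column_factor (u - k) * (?P / qpoch q q (nat e))"
    unfolding row_column_factor by (simp only:)
  have "((\<lambda>b::real. ?C * (qpoch (x / of_real b) q (nat e) / qpoch (y / of_real b) q (nat e))) \<longlongrightarrow>
      ?C * (x / y) ^ nat e) (at 0 within S)"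
    by (intro tendsto_mult tendsto_const qpoch_ratio_tendsto nonzero \<open>y \<noteq> 0\<close>)
  then show ?thesis
    unfolding lim by (simp add: x_def y_def mult_ac)
qed

text \<open>In row \<open>i\<close> the exponent of \<open>q\<close> is the summand of
  \<open>?E\<close> minus \<open>lam i - mu i\<close>; the latter part turns \<open>a / d\<close>
  into \<open>a / (q * d)\<close>.\<close>

lemma prod_row_column_factor:
  assumes lam: "is_partition lam" and mu: "is_partition mu" "mu \<le> lam"
  shows "(\<Prod>i<plength lam. row_factor (int (lam i) - int (Suc i)) *
        column_factor (int (mu i) - int (Suc i))) =
    (a / (q * d)) powi (int (psize lam) - int (psize mu)) *
    q powi (2 * (int (pn (ptranspose mu)) - int (pn mu)
                  - int (pn (ptranspose lam)) + int (pn lam)))"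
proof -
  let ?n = "plength lam" and ?l = "\<lambda>i. int (lam i)" and ?u = "\<lambda>i. int (mu i)"
  have le: "plength mu \<le> ?n" using mu lam by (intro plength_mono)
  let ?w = "int (psize lam) - int (psize mu)"
  let ?E = "2 * (int (pn (ptranspose mu)) - int (pn mu)
                  - int (pn (ptranspose lam)) + int (pn lam))"
  let ?f = "\<lambda>i. - ((?l i - ?u i) * (?l i - int (Suc i) + (?u i - int (Suc i)) + 2))"
  have w: "?w = (\<Sum>i<?n. ?l i - ?u i)"
    by (simp add: psize_eq_sum[OF lam order_refl] psize_eq_sum[OF mu(1) le] sum_subtractf)
  have pn: "2 * int (pn mu) = (\<Sum>i<?n. 2 * (int i * ?u i))" "2 * int (pn lam) = (\<Sum>i<?n. 2 * (int i * ?l i))"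
    by (simp_all add: pn_eq_sum[OF lam order_refl] pn_eq_sum[OF mu(1) le] sum_distrib_left)
  have "?E = (\<Sum>i<?n. ?u i * (?u i - 1) - 2 * (int i * ?u i) - ?l i * (?l i - 1) + 2 * (int i * ?l i))"
    unfolding right_diff_distrib distrib_left pn pn_ptranspose[OF lam order_refl]
      pn_ptranspose[OF mu(1) le] by (simp only: sum_subtractf sum.distrib)
  then have "(\<Sum>i<?n. ?f i) = - ?w + ?E"
    unfolding w sum_negf[symmetric]
    by (simp only: sum.distrib[symmetric]) (rule sum.cong, auto simp: algebra_simps)
  have "(\<Prod>i<?n. row_factor (?l i - int (Suc i)) * column_factor (?u i - int (Suc i))) =
      (\<Prod>i<?n. (a / d) powi (?l i - ?u i) * q powi ?f i)"
    by (simp add: row_column_factor)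
  also have "\<dots> = (a / d) powi ?w * q powi (- ?w + ?E)"
    using nonzero by (simp only: prod.distrib prod_power_int w \<open>(\<Sum>i<?n. ?f i) = - ?w + ?E\<close>
        divide_eq_0_iff not_False_eq_True simp_thms)
  also have "q powi (- ?w + ?E) = q powi (- ?w) * q powi ?E"
    using nonzero by (intro power_int_add) auto
  also have "(a / d) powi ?w * (q powi (- ?w) * q powi ?E) = (a / (q * d)) powi ?w * q powi ?E"
  proof -
    have "a / (q * d) = a / d * inverse q" by (simp add: field_simps)
    then have "(a / (q * d)) powi ?w = (a / d) powi ?w * q powi (- ?w)"
      by (simp only: power_int_mult_distrib power_int_inverse power_int_minus)
    then show ?thesis by simp
  qed
  finally show ?thesis .
qed

text \<open>The row and column factors pulled out of the limiting determinant are exactly the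
  prefactor of \<open>sigma_qM\<close>.\<close>

lemma sigma_bqJ_tendsto:
  assumes lam: "is_partition lam" and mu: "is_partition mu" "mu \<le> lam"
  shows "((\<lambda>b::real. sigma_bqJ lam mu q a (of_real b) c d) \<longlongrightarrow> sigma_qM lam mu q a c d)
    (at 0 within S)"
proof -
  define M where "M j k = (
       let l = int (lam (j - 1)); u = int (mu (k - 1));
           e = l - int j - u + int k; n = nat e
       in if e < 0 then 0
          else qpoch (c / a * q powi (u + 2 - int k)) q n / qpoch q q n)" for j k :: nat
  define r where "r j = row_factor (int (lam (j - 1)) - int j)" for j
  define s where "s k = column_factor (int (mu (k - 1)) - int k)" for k
  have "sigma_qM lam mu q a c d =
      c powi (- int (psize lam)) * det1 (plength lam) (\<lambda>j k. r j * s k * M j k)"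
    unfolding sigma_qM_def det1_mult_rows_columns M_def[symmetric]
    using prod_row_column_factor[OF assms] by (simp add: r_def s_def mult.assoc)
  moreover have "((\<lambda>b::real. sigma_bqJ lam mu q a (of_real b) c d) \<longlongrightarrow>
      c powi (- int (psize lam)) * det1 (plength lam) (\<lambda>j k. r j * s k * M j k)) (at 0 within S)"
    unfolding sigma_bqJ_def
  proof (intro tendsto_mult tendsto_const tendsto_det1)
    fix j k :: nat
    let ?l = "int (lam (j - 1))" and ?u = "int (mu (k - 1))"
    define e where "e = ?l - int j - ?u + int k"
    show "((\<lambda>b::real. let l = ?l; u = ?u; e = l - int j - u + int k; n = nat e
       in if e < 0 then 0
          else qpoch (c / a * q powi (u + 2 - int k)) q n *
               qpoch (c / of_real b * q powi (u + 2 - int k)) q n /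
               (q powi ((u + 1 - int k) * e) *
                (qpoch q q n *
                 qpoch (c * d / (a * of_real b) * q powi (l + u + 3 - int j - int k)) q n))) \<longlongrightarrow>
        r j * s k * M j k) (at 0 within S)"
    \<comment> \<open>For \<open>e < 0\<close> both entries are 0, whatever the row and column
      factors.\<close>
    proof (cases "e < 0")
      case True
      then show ?thesis by (simp add: M_def Let_def e_def)
    next
      case False
      then have "0 \<le> e" by simp
      then show ?thesis
        unfolding M_def r_def s_def Let_def e_def[symmetric] if_not_P[OF False]
        by (rule sigma_entry_tendsto[OF e_def])
    qed
  qed
  ultimately show ?thesis by simp
qed

end

lemma admissible_triple_nonzero:
  assumes "0 < q" "admissible_triple q a c d"
  shows "a \<noteq> 0" "c \<noteq> 0" "d \<noteq> 0"
proof -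
  show "a \<noteq> 0" using assms by (auto simp: admissible_triple_def)
  consider "c \<notin> \<real>" "d = cnj c" | m :: int where "both_between (a * q powi m) (a * q powi (m - 1)) c d"
    | "both_negative c d" and "a > 0"
    using assms by (auto simp: admissible_triple_def)
  then have "c \<noteq> 0 \<and> d \<noteq> 0"
  proof cases
    case (2 m)
    \<comment> \<open>The lower end of the interval is positive, hence so are \<open>c\<close> and
      \<open>d\<close>.\<close>
    moreover have "0 < a * q powi m" using assms by (simp add: admissible_triple_def)
    ultimately show ?thesis by (auto simp: both_between_def)
  qed (auto simp: both_negative_def)
  then show "c \<noteq> 0" "d \<noteq> 0" by auto
qed

theorem theorem5p4:
  fixes q a :: real and c d :: complex and lam :: "nat \<Rightarrow> nat"
  assumes "0 < q" and "q < 1"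
    and "admissible_triple q a c d"
    and "is_partition lam"
  shows "limitin (Sym_le_topology (psize lam))
           (\<lambda>b::real. Phi_bqJ lam (of_real q) (of_real a) (of_real b) c d)
           (Phi_qM lam (of_real q) (of_real a) c d)
           (at 0 within admissible_b q c d)"
proof -
  let ?I = "{mu. is_partition mu \<and> mu \<le> lam}"
  \<comment> \<open>Only the \<open>sigma\<close> coefficients depend on \<open>b\<close>; the
    functions they multiply are fixed elements of \<open>Sym_le (psize lam)\<close>.\<close>
  have I: "scale_vars c (I_A mu (of_real q)) \<in> Sym_le (psize lam)" if "mu \<in> ?I" for mu
    using that assms by (intro scaled_I_A_in_Sym_le) auto
  have "((\<lambda>b::real. sigma_bqJ lam mu (of_real q) (of_real a) (of_real b) c d) \<longlongrightarrow>
      sigma_qM lam mu (of_real q) (of_real a) c d) (at 0 within admissible_b q c d)"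
    if "mu \<in> ?I" for mu
    using that assms admissible_triple_nonzero[OF assms(1,3)]
    by (intro sigma_bqJ_tendsto) auto
  then show ?thesis
    unfolding limitin_Sym_le_topology Phi_bqJ_def Phi_qM_def
    by (intro conjI always_eventually allI sum_in_Sym_le I tendsto_sum tendsto_mult tendsto_const)
qed

end
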